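(* Let $\epsilon,\delta\in(0,1)$, $\gamma\in(0,1)$, and let the policies satisfy $B<\infty$. Suppose that almost surely there are no ties among the non-conformity scores $\tau_i$. Then the interval $\hat C_{\tilde\tau}$ produced by the known-behavior-policy procedure described in the context satisfies, for all $n\ge 1$, $$\mathbb P\big[L_{P^{\pi_e}}(\hat C_{\tilde\tau})\le \epsilon\big]\ <\ 1-\delta+\frac{C}{\sqrt n},$$ where $$C=\frac{7B}{\sqrt{\gamma\epsilon(1-\epsilon)}}+\sqrt{\lfloor m_0/\gamma\rfloor\, B}+\frac B2,\qquad m_0=\log_{1-\epsilon}\delta .$$
   Context: Setting. $\mathcal S$ (contexts) and $\mathcal A$ (actions) are measurable spaces; rewards are real. A policy $\pi$ maps each $s\in\mathcal S$ to a probability distribution $\pi(\cdot\mid s)$ on $\mathcal A$; $\pi(a\mid s)$ denotes its density (or mass function) with respect to a fixed reference measure $\mathrm da$. $P_S$ is a distribution on $\mathcal S$ and $P_R(\cdot\mid s,a)$ is a conditional reward distribution on $\mathbb R$. The behavior policy $\pi_b$ and the target policy $\pi_e$ are given. The data $\mathcal D=\{(S_i,A_i,R_i)\}_{i=1}^n$ are i.i.d. with $S_i\sim P_S$, $A_i\mid S_i\sim \pi_b(\cdot\mid S_i)$, $R_i\mid (S_i,A_i)\sim P_R(\cdot\mid S_i,A_i)$. The target distribution $P^{\pi_e}$ on $\mathcal S\times\mathbb R$ is the law of $(S,R)$ when $S\sim P_S$, $A\mid S\sim\pi_e(\cdot\mid S)$, $R\mid(S,A)\sim P_R(\cdot\mid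 S,A)$. The test pair $(S_{n+1},R_{n+1})\sim P^{\pi_e}$ is independent of everything used to build the interval. Put $w(s,a)=\pi_e(a\mid s)/\pi_b(a\mid s)$, with $w(s,a)=0$ if $\pi_e(a\mid s)=\pi_b(a\mid s)=0$, and $B=\inf\{b:\pi_e(a\mid s)\le b\,\pi_b(a\mid s)\text{ for all }(s,a)\}$. Known-behavior-policy procedure. 1. Rejection sampling: let $V_1,\dots,V_n$ be i.i.d. uniform on $[0,1]$, independent of $\mathcal D$. Let $\mathcal D_{\mathrm{rs}}$ consist of the pairs $(S_i,R_i)$ with $V_i\le w(S_i,A_i)/B$, listed in increasing order of $i$; $N_{\mathrm{rs}}$ is their number. 2. Split: $\mathcal D_{\mathrm{rs}}$ is split into $\mathcal D^{\mathrm{rs}}_1$ (training) of size $N_{\mathrm{rs}}-M$ and $\mathcal D^{\mathrm{rs}}_2$ (calibration) of size $M=\lceil\gamma N_{\mathrm{rs}}\rceil$; the choice of positions does not depend on the values of the data points. 3. Training: fix quantile levels $\epsilon_{\mathrm{lo}},\epsilon_{\mathrm{up}}\in[0,1]$ with $\epsilon_{\mathrm{up}}-\epsilon_{\mathrm{lo}}=1-\epsilon$. An arbitrary fixed algorithm without extra randomness maps $\mathcal D^{\mathrm{rs}}_1$ to measurable functions $\hat q_{\epsilon_{\mathrm{lo}}},\hat q_{\epsilon_{\mathrm{up}}}:\mathcal S\to\mathbb R$ (estimates of the conditional quantiles of $R$ given $S$). For $\tau\in\mathbb R\cup\{\infty\}$ put $\hat C_\tau(s)=[\hat q_{\epsilon_{\mathrm{lo}}}(s)-\tau,\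 \hat q_{\epsilon_{\mathrm{up}}}(s)+\tau]$ (empty if the lower endpoint exceeds the upper; equal to $\mathbb R$ if $\tau=\infty$). 4. Calibration: for $(S_i,R_i)\in\mathcal D^{\mathrm{rs}}_2$ put $\tau_i=\max\{\hat q_{\epsilon_{\mathrm{lo}}}(S_i)-R_i,\ R_i-\hat q_{\epsilon_{\mathrm{up}}}(S_i)\}$; let $\tau_{(1)}\le\dots\le\tau_{(M)}$ be the ordered values and $\tau_{(M+1)}=\infty$. With $F_{\mathrm{Bin}(M,\epsilon)}$ the binomial c.d.f., let $k(M,\epsilon,\delta)=\max\{k\in\{-1,0,\dots,M-1\}: F_{\mathrm{Bin}(M,\epsilon)}(k)\le\delta\}$ (where $F_{\mathrm{Bin}(M,\epsilon)}(-1)=0$). Set $\tilde\tau=\tau_{(M-k(M,\epsilon,\delta))}$. The output is $\hat C_{\tilde\tau}$. Miscoverage. $L_{P^{\pi_e}}(\hat C)$ is the conditional probability that $R_{n+1}\notin\hat C(S_{n+1})$ given everything used to construct $\hat C$ (i.e. $\mathcal D$, the $V_i$ and the split); it is a random variable. The outer probability $\mathbb P$ is over all this randomness. *)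

theory Defs
  imports "HOL-Probability.Probability"
begin

text \<open>
  The context space is carried by the context law \<open>PS\<close>, the action space by the reference
  measure \<open>da\<close>; a policy is given by its conditional density \<open>p s a\<close> with respect to \<open>da\<close>.
  Kernel measurability is demanded separately because \<open>da\<close> is not assumed sigma-finite (for
  sigma-finite \<open>da\<close> it follows from joint measurability of the density).
\<close>

definition policy :: "'s measure \<Rightarrow> 'a measure \<Rightarrow> ('s \<Rightarrow> 'a \<Rightarrow> real) \<Rightarrow> bool" where
  "policy PS da p \<longleftrightarrow>
     (\<lambda>(s, a). p s a) \<in> borel_measurable (PS \<Otimes>\<^sub>M da) \<and>
     (\<forall>s\<in>space PS. \<forall>a\<in>space da. 0 \<le> p s a) \<and>
     (\<lambda>s. density da (\<lambda>a. ennreal (p s a))) \<in> PS \<rightarrow>\<^sub>M prob_algebra da"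

definition data_law ::
  "'s measure \<Rightarrow> 'a measure \<Rightarrow> ('s \<times> 'a \<Rightarrow> real measure) \<Rightarrow> ('s \<Rightarrow> 'a \<Rightarrow> real)
    \<Rightarrow> ('s \<times> 'a \<times> real) measure" where
  "data_law PS da PR p =
     PS \<bind> (\<lambda>s. density da (\<lambda>a. ennreal (p s a)) \<bind> (\<lambda>a. PR (s, a) \<bind>
       (\<lambda>r. return (PS \<Otimes>\<^sub>M da \<Otimes>\<^sub>M borel) (s, a, r))))"

definition target_law ::
  "'s measure \<Rightarrow> 'a measure \<Rightarrow> ('s \<times> 'a \<Rightarrow> real measure) \<Rightarrow> ('s \<Rightarrow> 'a \<Rightarrow> real)
    \<Rightarrow> ('s \<times> real) measure" where
  "target_law PS da PR p =
     distr (data_law PS da PR p) (PS \<Otimes>\<^sub>M borel) (\<lambda>(s, a, r). (s, r))"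

text \<open>The convention \<open>0 / 0 = 0\<close> for the weight is the one built into division.\<close>

definition weight :: "('s \<Rightarrow> 'a \<Rightarrow> real) \<Rightarrow> ('s \<Rightarrow> 'a \<Rightarrow> real) \<Rightarrow> 's \<Rightarrow> 'a \<Rightarrow> real" where
  "weight pe pb s a = pe s a / pb s a"

text \<open>The infimum of the empty set is \<open>\<infinity>\<close> here.\<close>

definition ratio_bound ::
  "'s measure \<Rightarrow> 'a measure \<Rightarrow> ('s \<Rightarrow> 'a \<Rightarrow> real) \<Rightarrow> ('s \<Rightarrow> 'a \<Rightarrow> real) \<Rightarrow> ereal" where
  "ratio_bound PS da pe pb =
     Inf (ereal ` {b. \<forall>s\<in>space PS. \<forall>a\<in>space da. pe s a \<le> b * pb s a})"

definition rejection_sample ::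
  "('s \<Rightarrow> 'a \<Rightarrow> real) \<Rightarrow> real \<Rightarrow> nat \<Rightarrow> (nat \<Rightarrow> 's \<times> 'a \<times> real) \<Rightarrow> (nat \<Rightarrow> real)
    \<Rightarrow> ('s \<times> real) list" where
  "rejection_sample w B n d v =
     map (\<lambda>i. case d i of (s, a, r) \<Rightarrow> (s, r))
       (filter (\<lambda>i. case d i of (s, a, r) \<Rightarrow> v i \<le> w s a / B) [0..<n])"

text \<open>
  A split is a function \<open>J\<close> that assigns to every sample size \<open>N\<close> the set of calibration
  positions \<open>J N \<subseteq> {..<N}\<close>; the remaining positions are used for training.
\<close>

definition training_set :: "(nat \<Rightarrow> nat set) \<Rightarrow> 'b list \<Rightarrow> 'b list" where
  "training_set J xs = nths xs (- J (length xs))"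

definition calibration_set :: "(nat \<Rightarrow> nat set) \<Rightarrow> 'b list \<Rightarrow> 'b list" where
  "calibration_set J xs = nths xs (J (length xs))"

text \<open>
  A training algorithm \<open>q\<close> maps a quantile level and a training list to a function of the
  context. It is measurable jointly in the training data (of each size) and the context.
\<close>

definition measurable_training ::
  "'s measure \<Rightarrow> (('s \<times> real) list \<Rightarrow> 's \<Rightarrow> real) \<Rightarrow> bool" where
  "measurable_training PS q \<longleftrightarrow>
     (\<forall>m. (\<lambda>(x, s). q (map x [0..<m]) s)
        \<in> borel_measurable (PiM {..<m} (\<lambda>_. PS \<Otimes>\<^sub>M borel) \<Otimes>\<^sub>M PS))"

definition score :: "('s \<Rightarrow> real) \<Rightarrow> ('s \<Rightarrow> real) \<Rightarrow> 's \<times> real \<Rightarrow> real" where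
  "score qlo qup = (\<lambda>(s, r). max (qlo s - r) (r - qup s))"

definition band :: "('s \<Rightarrow> real) \<Rightarrow> ('s \<Rightarrow> real) \<Rightarrow> ereal \<Rightarrow> 's \<Rightarrow> real set" where
  "band qlo qup \<tau> s = {r. ereal (qlo s) - \<tau> \<le> ereal r \<and> ereal r \<le> ereal (qup s) + \<tau>}"

definition binomial_cdf :: "nat \<Rightarrow> real \<Rightarrow> int \<Rightarrow> real" where
  "binomial_cdf m p k = measure_pmf.prob (binomial_pmf m p) {j. int j \<le> k}"

definition kidx :: "nat \<Rightarrow> real \<Rightarrow> real \<Rightarrow> int" where
  "kidx m \<epsilon> \<delta> = Max {k. -1 \<le> k \<and> k \<le> int m - 1 \<and> binomial_cdf m \<epsilon> k \<le> \<delta>}"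

text \<open>Order statistics are counted from 1; the one beyond the sample size is \<open>\<infinity>\<close>.\<close>

definition order_stat :: "real list \<Rightarrow> nat \<Rightarrow> ereal" where
  "order_stat xs j = (if j \<le> length xs then ereal (sort xs ! (j - 1)) else \<infinity>)"

definition calibration_scores ::
  "(real \<Rightarrow> ('s \<times> real) list \<Rightarrow> 's \<Rightarrow> real) \<Rightarrow> real \<Rightarrow> real \<Rightarrow> (nat \<Rightarrow> nat set)
    \<Rightarrow> ('s \<times> real) list \<Rightarrow> real list" where
  "calibration_scores q \<epsilon>lo \<epsilon>up J xs =
     map (score (q \<epsilon>lo (training_set J xs)) (q \<epsilon>up (training_set J xs))) (calibration_set J xs)"

definition threshold :: "real \<Rightarrow> real \<Rightarrow> real list \<Rightarrow> ereal" where
  "threshold \<epsilon> \<delta> ts = order_stat ts (nat (int (length ts) - kidx (length ts) \<epsilon> \<delta>))"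

definition prediction_interval ::
  "(real \<Rightarrow> ('s \<times> real) list \<Rightarrow> 's \<Rightarrow> real) \<Rightarrow> real \<Rightarrow> real \<Rightarrow> real \<Rightarrow> real \<Rightarrow> (nat \<Rightarrow> nat set)
    \<Rightarrow> ('s \<times> real) list \<Rightarrow> 's \<Rightarrow> real set" where
  "prediction_interval q \<epsilon>lo \<epsilon>up \<epsilon> \<delta> J xs =
     band (q \<epsilon>lo (training_set J xs)) (q \<epsilon>up (training_set J xs))
       (threshold \<epsilon> \<delta> (calibration_scores q \<epsilon>lo \<epsilon>up J xs))"

definition data_space ::
  "nat \<Rightarrow> 's measure \<Rightarrow> 'a measure \<Rightarrow> (nat \<Rightarrow> 's \<times> 'a \<times> real) measure" where
  "data_space n PS da = PiM {..<n} (\<lambda>_. PS \<Otimes>\<^sub>M da \<Otimes>\<^sub>M borel)"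

definition split_space :: "(nat \<Rightarrow> nat set) measure" where
  "split_space = PiM UNIV (\<lambda>N. count_space (Pow {..<N}))"

text \<open>
  Independence of two random elements whose value types may differ (the library notion
  \<open>indep_var\<close> requires a common value type): the generated families of events are independent.
\<close>

definition indep_elements ::
  "'w measure \<Rightarrow> 'x measure \<Rightarrow> ('w \<Rightarrow> 'x) \<Rightarrow> 'y measure \<Rightarrow> ('w \<Rightarrow> 'y) \<Rightarrow> bool" where
  "indep_elements M N X K Y \<longleftrightarrow>
     X \<in> M \<rightarrow>\<^sub>M N \<and> Y \<in> M \<rightarrow>\<^sub>M K \<and>
     prob_space.indep_set M {X -` A \<inter> space M | A. A \<in> sets N} {Y -` A \<inter> space M | A. A \<in> sets K}"

text \<open>Conditional probability of \<open>y \<omega> \<notin> I \<omega> (s \<omega>)\<close> given the random element \<open>X\<close> of \<open>N\<close>.\<close>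

definition miscoverage ::
  "'w measure \<Rightarrow> 'x measure \<Rightarrow> ('w \<Rightarrow> 'x) \<Rightarrow> ('w \<Rightarrow> 's \<Rightarrow> real set) \<Rightarrow> ('w \<Rightarrow> 's) \<Rightarrow> ('w \<Rightarrow> real)
    \<Rightarrow> 'w \<Rightarrow> real" where
  "miscoverage M N X I s y =
     real_cond_exp M (vimage_algebra (space M) X N)
       (indicator {\<omega> \<in> space M. y \<omega> \<notin> I \<omega> (s \<omega>)})"

end

theory Submission
  imports Defs
begin

text \<open>
  Given the set of accepted indices and the calibration positions, the accepted pairs are i.i.d.
  with the target law \<open>Q\<close>, and a.s. the miscoverage is \<open>Q(score > threshold)\<close>. Given the training
  part, if the score has no atoms and \<open>t0\<close> is its least upper \<open>\<epsilon>\<close>-quantile, miscoverage at most \<open>\<epsilon>\<close> means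
  that more than \<open>k(M, \<epsilon>, \<delta>)\<close> of the \<open>M\<close> calibration scores are at least \<open>t0\<close>, and their number is
  binomial with parameters \<open>M\<close> and \<open>\<epsilon>\<close>. By maximality of \<open>k(M, \<epsilon>, \<delta>)\<close> the probability exceeds
  \<open>1 - \<delta>\<close> by at most one binomial point mass, hence by at most \<open>1 / sqrt (2 M \<epsilon> (1 - \<epsilon>))\<close>. Almost sure
  absence of ties rules out atoms once \<open>M \<ge> 2\<close>; for \<open>M = 1\<close> the bound is trivial. The number \<open>N\<close> of
  accepted pairs is binomial with parameters \<open>n\<close> and \<open>1/B\<close>, so averaging \<open>1 / sqrt (N + 1)\<close> costs at most
  \<open>sqrt (B / (n + 1))\<close>; this already stays below the first summand of the constant.
\<close>

section \<open>Binomial weights\<close>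

text \<open>The obstacle is that the size of the accepted sample is random and the split is
  evaluated at this random size, so no single product measure carries the calibration argument.
  Fixing the whole set \<open>A\<close> of accepted indices, and not only its size, makes acceptance
  a product event with one factor per index; position \<open>j\<close> of the accepted list then has
  a fixed original index. On that piece the split is a position set \<open>K\<close>, whose
  probability factors out by independence. Almost sure absence of ties passes from the joint law to
  each piece \<open>(A, K)\<close> of positive probability. Atoms must be excluded because an atom
  at the quantile could make the chance of a score \<ge> \<open>t0\<close> exceed \<epsilon>, and
  the coverage event would no longer be tied to a binomial law with parameter exactly \<epsilon>.
  Small samples with \<open>kidx = -1\<close> need no separate estimate: the threshold is infinite,
  the event is certain, and the point mass at 0 pays for it. Averages are taken of 1 / sqrt (N + 1)
  rather than 1 / sqrt N: this is finite at N = 0, and 1 / (N + 1) has a closed-form binomial mean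
  up to one missing term.\<close>

lemma central_binomial_bound: "((2*n) choose n)\<^sup>2 * (2*n+1) \<le> (16::nat)^n"
proof (induction n)
  case (Suc n)
  have r: "(Suc n) * ((2 * Suc n) choose Suc n) = 2 * (2*n+1) * ((2*n) choose n)"
  proof -
    have a: "Suc n * (Suc (2*n+1) choose Suc n) = Suc (2*n+1) * ((2*n+1) choose n)"
      using Suc_times_binomial_eq[of "2*n+1" n] by (simp add: mult.commute)
    have b: "((2*n+1) choose n) = ((2*n+1) choose Suc n)"
      using binomial_symmetric[of n "2*n+1"] by simp
    have c: "Suc n * (Suc (2*n) choose Suc n) = Suc (2*n) * ((2*n) choose n)"
      using Suc_times_binomial_eq[of "2*n" n] by (simp add: mult.commute)
    have "Suc n * (Suc n * ((2 * Suc n) choose Suc n)) = Suc n * (2 * (2*n+1) * ((2*n) choose n))"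
    proof -
      have "2 * Suc n = Suc (2*n+1)" "Suc (2*n+1) = 2 * Suc n" "Suc (2*n) = 2*n+1" by simp_all
      then have "Suc n * ((2 * Suc n) choose Suc n) = 2 * Suc n * ((2*n+1) choose n)"
        using a by metis
      moreover have "Suc n * ((2*n+1) choose n) = (2*n+1) * ((2*n) choose n)"
        using b c by simp
      ultimately show ?thesis by (metis (no_types, lifting) mult.assoc mult.left_commute)
    qed
    then show ?thesis by (simp only: Suc_mult_cancel1)
  qed
  have "(Suc n)\<^sup>2 * (((2 * Suc n) choose Suc n)\<^sup>2 * (2*Suc n+1))
      = (2 * (2*n+1) * ((2*n) choose n))\<^sup>2 * (2*Suc n+1)"
    using r by (metis (no_types, lifting) mult.assoc power_mult_distrib)
  \<comment> \<open>The factor \<open>2*n+1\<close> makes the induction close: passing to n + 1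
    multiplies the left side by 4 (2n+1)(2n+3) / (n+1)^2, which is below 16 because (2n+1)(2n+3) = 4
    (n+1)^2 - 1.\<close>
  also have "\<dots> = 4 * ((2*n+1) * (2*n+3)) * (((2*n) choose n)\<^sup>2 * (2*n+1))"
    by (simp add: power2_eq_square algebra_simps)
  also have "\<dots> \<le> (16 * (Suc n)\<^sup>2) * 16^n"
    by (rule mult_le_mono[OF _ Suc.IH]) (simp add: power2_eq_square algebra_simps)
  finally show ?case by simp
qed simp

text \<open>The middle coefficient dominates its row. An even row is the central bound itself. An
  odd row K is compared with row K + 1, whose central coefficient is twice the middle one of row K;
  this even leaves K + 2 in place of K + 1.\<close>

lemma binomial_coeff_bound: "((K choose j)::nat)\<^sup>2 * (K+1) \<le> 4^K"
proof -
  have le: "(K choose j) \<le> (K choose (K div 2))" by (rule binomial_maximum)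
  have "(K choose (K div 2))\<^sup>2 * (K+1) \<le> 4^K"
  proof (cases "even K")
    case True
    then obtain n where "K = 2*n" by auto
    then show ?thesis using central_binomial_bound[of n] by (simp add: power_mult)
  next
    case False
    then obtain n where K: "K = 2*n+1" by (auto elim: oddE)
    have b: "((2*n+1) choose n) = ((2*n+1) choose Suc n)"
      using binomial_symmetric[of n "2*n+1"] by simp
    have "((2*Suc n) choose Suc n) = 2 * (K choose n)"
      using b K by simp
    then have "(2 * (K choose n))\<^sup>2 * (2 * Suc n + 1) \<le> 16 ^ Suc n"
      using central_binomial_bound[of "Suc n"] by simp
    moreover have "(16::nat) ^ Suc n = 4 * 4 ^ K" by (simp add: K power_mult)
    ultimately have "(K choose n)\<^sup>2 * (2 * Suc n + 1) \<le> 4 ^ K" by (simp add: power_mult_distrib)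
    moreover have "(K choose n)\<^sup>2 * (K + 1) \<le> (K choose n)\<^sup>2 * (2 * Suc n + 1)"
      using K by (intro mult_left_mono) auto
    ultimately show ?thesis using K by simp
  qed
  moreover have "(K choose j)\<^sup>2 * (K+1) \<le> (K choose (K div 2))\<^sup>2 * (K+1)"
    using le by (intro mult_right_mono power_mono) auto
  ultimately show ?thesis by linarith
qed

lemma binomial_coeff_le:
  "real (K choose j) / 2^K \<le> 1 / sqrt (real K + 1)"
proof -
  have "real ((K choose j)\<^sup>2 * (K+1)) \<le> real (4^K)"
    using binomial_coeff_bound of_nat_le_iff by blast
  then have "(real (K choose j))\<^sup>2 * (real K + 1) \<le> 4 ^ K" by (simp add: algebra_simps)
  also have "(4::real) ^ K = (2^K)\<^sup>2" by (simp flip: power_mult_distrib add: power2_eq_square)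
  finally have "(real (K choose j) * sqrt (real K + 1))\<^sup>2 \<le> (2^K)\<^sup>2"
    by (simp add: power_mult_distrib)
  then have "real (K choose j) * sqrt (real K + 1) \<le> 2^K"
    by (rule power2_le_imp_le) simp
  then show ?thesis by (simp add: field_simps)
qed

text \<open>The binomial point mass as a polynomial in \<open>r\<close>, so that identities hold for
  every real \<open>r\<close>; it vanishes for \<open>k\<close> beyond \<open>m\<close> together
  with the coefficient.\<close>

definition binom_weight :: "nat \<Rightarrow> real \<Rightarrow> nat \<Rightarrow> real" where
  "binom_weight m r k = real (m choose k) * r^k * (1-r)^(m-k)"

lemma binom_weight_nonneg: "r \<in> {0..1} \<Longrightarrow> binom_weight m r k \<ge> 0"
  by (simp add: binom_weight_def)

lemma sum_binom_weight: "(\<Sum>k\<le>m. binom_weight m r k) = 1"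
  using binomial_ring[of r "1-r" m] by (simp add: binom_weight_def)

text \<open>Absorbing 1 / (k + 1) into the coefficient turns the sum into one over the positive
  values of a binomial variable with m + 1 trials. The inequality discards only the mass at
  0.\<close>

lemma sum_binom_weight_inverse:
  assumes r: "r \<in> {0<..1}"
  shows "(\<Sum>k\<le>m. binom_weight m r k / (real k + 1)) \<le> 1 / (r * (real m + 1))"
proof -
  have e: "binom_weight m r k / (real k + 1) = binom_weight (Suc m) r (Suc k) / (r * (real m + 1))" for k
  proof -
    have "real (Suc k) * real (Suc m choose Suc k) = real (Suc m) * real (m choose k)"
      by (metis Suc_times_binomial_eq mult.commute of_nat_mult)
    then have "real (m choose k) / (real k + 1) = real (Suc m choose Suc k) / (real m + 1)"
      by (simp add: field_simps del: binomial_Suc_Suc)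
    then have "real (m choose k) / (real k + 1) * (r ^ k * (1 - r) ^ (m - k)) = real (Suc m choose Suc k) / (real m + 1)* (r ^ k * (1 - r) ^ (m - k))"
      by simp
    then show ?thesis using r by (simp add: binom_weight_def mult_ac del: binomial_Suc_Suc)
  qed
  have "(\<Sum>k\<le>m. binom_weight (Suc m) r (Suc k)) \<le> (\<Sum>k\<le>Suc m. binom_weight (Suc m) r k)"
    using binom_weight_nonneg[of r "Suc m" 0] r by (simp only: sum.atMost_Suc_shift) simp
  also have "\<dots> = 1" by (rule sum_binom_weight)
  finally show ?thesis
    using r by (simp add: e flip: sum_divide_distrib) (simp add: divide_right_mono)
qed

text \<open>Cauchy-Schwarz against the total mass one. It serves twice: with r = 2p for the number
  of fair tosses behind a point mass, and with r = 1/B for the number of accepted pairs.\<close>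

lemma sum_binom_weight_inverse_sqrt:
  assumes r: "r \<in> {0<..1}"
  shows "(\<Sum>k\<le>m. binom_weight m r k / sqrt (real k + 1)) \<le> 1 / sqrt (r * (real m + 1))"
proof -
  let ?b = "binom_weight m r"
  have nn: "?b k \<ge> 0" for k using r by (simp add: binom_weight_nonneg)
  have "(\<Sum>k\<le>m. ?b k / sqrt (real k + 1))\<^sup>2 = (\<Sum>k\<le>m. sqrt (?b k) * (sqrt (?b k) / sqrt (real k + 1)))\<^sup>2"
    using nn by (simp add: real_sqrt_mult_self flip: mult.assoc)
  also have "\<dots> \<le> (\<Sum>k\<le>m. (sqrt (?b k))\<^sup>2) * (\<Sum>k\<le>m. (sqrt (?b k) / sqrt (real k + 1))\<^sup>2)"
    by (rule Cauchy_Schwarz_ineq_sum)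
  also have "\<dots> = (\<Sum>k\<le>m. ?b k / (real k + 1))"
    using nn by (simp add: power_divide sum_binom_weight)
  also have "\<dots> \<le> 1 / (r * (real m + 1))" by (rule sum_binom_weight_inverse[OF r])
  finally have "\<bar>\<Sum>k\<le>m. ?b k / sqrt (real k + 1)\<bar> \<le> sqrt (1 / (r * (real m + 1)))"
    by (rule real_le_rsqrt[OF order_trans[rotated]]) simp
  then show ?thesis by (simp add: real_sqrt_divide)
qed

text \<open>A coin of bias \<open>p \<le> 1/2\<close> can be tossed by tossing a fair coin with probability \<open>2p\<close> (and reporting tails
  otherwise); conditioning on the number of fair tosses reduces point masses to \<open>(k choose j) / 2\<^sup>k\<close>.\<close>

lemma binom_weight_thinning:
  assumes "j \<le> m"
  shows "binom_weight m p j = (\<Sum>k\<le>m. binom_weight m (2*p) k * (real (k choose j) / 2^k))"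
proof -
  have "(\<Sum>k\<le>m. binom_weight m (2*p) k * (real (k choose j) / 2^k))
      = (\<Sum>k\<in>{j..m}. binom_weight m (2*p) k * (real (k choose j) / 2^k))"
    by (rule sum.mono_neutral_right) auto
  also have "\<dots> = (\<Sum>k\<in>{j..m}. real (m choose j) * p^j * (real ((m-j) choose (k-j)) * p^(k-j) * (1-2*p)^(m-k)))"
  proof (rule sum.cong[OF refl])
    fix k assume k: "k \<in> {j..m}"
    have "real (m choose k) * real (k choose j) = real (m choose j) * real ((m-j) choose (k-j))"
      using choose_mult[of j k m] k by (metis atLeastAtMost_iff of_nat_mult)
    moreover have "p^k = p^j * p^(k-j)" using k by (simp flip: power_add)
    ultimately show "binom_weight m (2*p) k * (real (k choose j) / 2^k)
      = real (m choose j) * p^j * (real ((m-j) choose (k-j)) * p^(k-j) * (1-2*p)^(m-k))"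
      by (simp add: binom_weight_def power_mult_distrib) 
  qed
  also have "\<dots> = real (m choose j) * p^j * (\<Sum>k\<in>{j..m}. real ((m-j) choose (k-j)) * p^(k-j) * (1-2*p)^(m-k))"
    by (simp add: sum_distrib_left)
  also have "(\<Sum>k\<in>{j..m}. real ((m-j) choose (k-j)) * p^(k-j) * (1-2*p)^(m-k))
      = (\<Sum>i\<le>m-j. real ((m-j) choose i) * p^i * (1-2*p)^(m-j-i))"
    by (rule sum.reindex_bij_witness[of _ "\<lambda>i. i+j" "\<lambda>k. k-j"]) (use assms in auto)
  \<comment> \<open>Each of the m - j tosses without a head is either a fair toss showing tails,
    with weight p, or no fair toss at all, with weight 1 - 2p.\<close>
  also have "\<dots> = (1-p)^(m-j)"
    using binomial_ring[of p "1-2*p" "m-j"] by simp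
  finally show ?thesis by (simp add: binom_weight_def)
qed

lemma binom_weight_le_half:
  assumes p: "0 < p" "p \<le> 1/2" and j: "j \<le> m"
  shows "binom_weight m p j \<le> 1 / sqrt (2 * p * (real m + 1))"
proof -
  have "binom_weight m p j \<le> (\<Sum>k\<le>m. binom_weight m (2*p) k * (1 / sqrt (real k + 1)))"
    unfolding binom_weight_thinning[OF j]
    by (intro sum_mono mult_left_mono binomial_coeff_le binom_weight_nonneg) (use p in auto)
  also have "\<dots> \<le> 1 / sqrt (2 * p * (real m + 1))"
    using sum_binom_weight_inverse_sqrt[of "2*p" m] p by simp
  finally show ?thesis .
qed

lemma binom_weight_flip: "j \<le> m \<Longrightarrow> binom_weight m (1-p) j = binom_weight m p (m-j)"
  by (simp add: binom_weight_def binomial_symmetric[of j m] mult_ac)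

text \<open>Exchanging success and failure reduces to a bias of at most 1/2. The bound is then
  weakened to the symmetric product p (1 - p), which is at most either factor.\<close>

lemma binom_weight_le:
  assumes p: "0 < p" "p < 1" and j: "j \<le> m" and m: "m > 0"
  shows "binom_weight m p j \<le> 1 / sqrt (2 * real m * p * (1-p))"
proof -
  have *: "1 / sqrt (2 * a * (real m + 1)) \<le> 1 / sqrt (2 * real m * p * (1-p))"
    if "a = p \<or> a = 1-p" for a
  proof -
    have "2 * real m * p * (1-p) = 2 * real m * (p * (1-p))" by simp
    also have "\<dots> \<le> 2 * real m * a"
      using that p m mult_left_le[of "1-p" p] mult_left_le[of p "1-p"]
      by (intro mult_left_mono) (auto simp: mult.commute)
    also have "\<dots> \<le> 2 * a * (real m + 1)" using that p by (auto simp: algebra_simps)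
    finally have "sqrt (2 * real m * p * (1-p)) \<le> sqrt (2 * a * (real m + 1))" by simp
    then show ?thesis using p m by (intro frac_le) auto
  qed
  show ?thesis
  proof (cases "p \<le> 1/2")
    case True
    then show ?thesis using binom_weight_le_half[of p j m] *[of p] p j by force
  next
    case False
    have "binom_weight m p j = binom_weight m (1-p) (m-j)"
      using binom_weight_flip[of j m "1-p"] j by simp
    then show ?thesis using binom_weight_le_half[of "1-p" "m-j" m] *[of "1-p"] p j False by force
  qed
qed

text \<open>Used for sets of hits among the calibration scores and for sets of accepted indices: in
  both cases it turns a sum over index sets into a sum of binomial weights.\<close>

lemma sum_Pow_card:
  assumes "finite A"
  shows "(\<Sum>B\<in>Pow A. f (card B)) = (\<Sum>k\<le>card A. real (card A choose k) * f k)"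
proof -
  have "(\<Sum>B\<in>Pow A. f (card B)) = (\<Sum>k\<in>{..card A}. \<Sum>B | B \<in> Pow A \<and> card B = k. f (card B))"
    using assms by (intro sum.group[symmetric]) (auto intro: card_mono)
  also have "\<dots> = (\<Sum>k\<le>card A. real (card A choose k) * f k)"
    using n_subsets[OF assms] by (intro sum.cong) auto
  finally show ?thesis .
qed

section \<open>Order statistics and calibration on an i.i.d. sample\<close>

lemma sorted_nth_iff_filter:
  assumes "sorted xs" "\<And>x y. x \<le> y \<Longrightarrow> P y \<Longrightarrow> P x" "j < length xs"
  shows "P (xs ! j) \<longleftrightarrow> j < length (filter P xs)"
  using assms(1,3)
proof (induction xs arbitrary: j)
  case (Cons a xs)
  show ?case
  proof (cases "P a")
    case True
    then show ?thesis using Cons by (cases j) auto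
  next
    case False
    then have "\<forall>x\<in>set (a # xs). \<not> P x" using Cons.prems(1) assms(2) by auto
    then have "filter P (a # xs) = []" by (simp only: filter_empty_conv)
    moreover have "\<not> P ((a # xs) ! j)"
      using \<open>\<forall>x\<in>set (a # xs). \<not> P x\<close> Cons.prems(2) nth_mem by blast
    ultimately show ?thesis by simp
  qed
qed simp

text \<open>Trades an order statistic for a count, which ignores the order of the list. Both the
  measurability of the threshold and its reading as a number of large scores rest on this.\<close>

lemma sort_nth_iff_filter:
  fixes xs :: "'a::linorder list"
  assumes "\<And>x y. x \<le> y \<Longrightarrow> P y \<Longrightarrow> P x" "j < length xs"
  shows "P (sort xs ! j) \<longleftrightarrow> j < length (filter P xs)"
  using sorted_nth_iff_filter[of "sort xs" P j] assms by (simp add: filter_sort)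

lemma binomial_cdf_eq:
  assumes "p \<in> {0..1}"
  shows "binomial_cdf m p k = (\<Sum>j\<le>m. if int j \<le> k then binom_weight m p j else 0)"
proof -
  let ?S = "{j. int j \<le> k} \<inter> {..m}"
  have "set_pmf (binomial_pmf m p) \<subseteq> {..m}"
    using assms by (auto simp: set_pmf_binomial_eq split: if_splits)
  then have "binomial_cdf m p k = measure_pmf.prob (binomial_pmf m p) ?S"
    unfolding binomial_cdf_def
    by (intro measure_pmf.finite_measure_eq_AE) (auto simp: AE_measure_pmf_iff)
  also have "\<dots> = (\<Sum>j\<in>?S. binom_weight m p j)"
    using assms by (subst measure_measure_pmf_finite) (auto simp: binom_weight_def)
  also have "\<dots> = (\<Sum>j\<le>m. if int j \<le> k then binom_weight m p j else 0)"
    by (subst Int_commute, subst sum.inter_restrict) auto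
  finally show ?thesis .
qed

lemma kidx_props:
  assumes "\<epsilon> \<in> {0<..<1}" "\<delta> \<in> {0<..<1}" "m > 0"
  shows "kidx m \<epsilon> \<delta> \<in> {-1..int m - 1}"
    and "(\<Sum>j\<le>m. if int j > kidx m \<epsilon> \<delta> then binom_weight m \<epsilon> j else 0)
      \<le> 1 - \<delta> + binom_weight m \<epsilon> (nat (kidx m \<epsilon> \<delta> + 1))"
proof -
  let ?S = "{k. -1 \<le> k \<and> k \<le> int m - 1 \<and> binomial_cdf m \<epsilon> k \<le> \<delta>}"
  let ?k = "kidx m \<epsilon> \<delta>"
  have eps: "\<epsilon> \<in> {0..1}" using assms by auto
  have fin: "finite ?S" by (rule finite_subset[of _ "{-1..int m - 1}"]) auto
  have "-1 \<in> ?S" using assms by (simp add: binomial_cdf_eq[OF eps])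
  then have k: "?k \<in> ?S" unfolding kidx_def using fin by (intro Max_in) auto
  then show range: "?k \<in> {-1..int m - 1}" by auto
  \<comment> \<open>Here maximality enters. If \<open>?k\<close> is already m - 1, the next index
    lies outside the range of the maximum, but there the c.d.f. equals 1 and exceeds \<delta>
    anyway.\<close>
  have big: "\<delta> < binomial_cdf m \<epsilon> (?k + 1)"
  proof (rule ccontr)
    assume "\<not> ?thesis"
    then have le: "binomial_cdf m \<epsilon> (?k + 1) \<le> \<delta>" by simp
    show False
    proof (cases "?k + 1 \<le> int m - 1")
      case True
      then have "?k + 1 \<in> ?S" using le range by auto
      then have "?k + 1 \<le> ?k" unfolding kidx_def using fin by (intro Max_ge)
      then show False by simp
    next
      case False
      then have "?k + 1 = int m" using range by auto
      then have "binomial_cdf m \<epsilon> (?k + 1) = 1"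
        using sum_binom_weight[of m \<epsilon>] by (simp add: binomial_cdf_eq[OF eps])
      then show False using le assms by simp
    qed
  qed
  \<comment> \<open>The tail above \<open>?k\<close> is expressed by the c.d.f. at
    \<open>?k + 1\<close>, the point where a lower bound is known; the price is the single mass at
    \<open>?k + 1\<close>. Since \<open>?k\<close> \<ge> -1, the conversion by \<open>nat\<close>
    loses nothing.\<close>
  have "(\<Sum>j\<le>m. if int j > ?k then binom_weight m \<epsilon> j else 0)
      = (\<Sum>j\<le>m. binom_weight m \<epsilon> j - (if int j \<le> ?k + 1 then binom_weight m \<epsilon> j else 0)
           + (if j = nat (?k + 1) then binom_weight m \<epsilon> j else 0))"
    using range by (intro sum.cong) auto
  also have "\<dots> = 1 - binomial_cdf m \<epsilon> (?k + 1) + binom_weight m \<epsilon> (nat (?k + 1))"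
    using range by (simp add: sum.distrib sum_subtractf sum_binom_weight binomial_cdf_eq[OF eps] sum.delta)
      (simp add: binom_weight_def)
  finally show "(\<Sum>j\<le>m. if int j > ?k then binom_weight m \<epsilon> j else 0)
      \<le> 1 - \<delta> + binom_weight m \<epsilon> (nat (?k + 1))" using big by simp
qed

section \<open>Hit counts in a product measure, atoms and quantiles\<close>

lemma prob_hit_set_PiM:
  assumes "prob_space Q" and A: "A \<in> sets Q" and I: "finite I" and B: "B \<subseteq> I"
  shows "{x \<in> space (PiM I (\<lambda>_. Q)). {i\<in>I. x i \<in> A} = B} \<in> sets (PiM I (\<lambda>_. Q))" (is "?E \<in> _")
    and "measure (PiM I (\<lambda>_. Q)) {x \<in> space (PiM I (\<lambda>_. Q)). {i\<in>I. x i \<in> A} = B}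
      = measure Q A ^ card B * (1 - measure Q A) ^ (card I - card B)"
proof -
  interpret prob_space Q by fact
  interpret P: finite_product_prob_space "\<lambda>_. Q" I
    by standard (rule I)
  let ?X = "\<lambda>i. if i \<in> B then A else space Q - A"
  have E: "?E = (\<Pi>\<^sub>E i\<in>I. ?X i)"
    using B sets.sets_into_space[OF A]
    by (simp add: set_eq_iff space_PiM PiE_iff) (metis subsetD)
  show "?E \<in> sets (PiM I (\<lambda>_. Q))"
    unfolding E using A I by (intro sets_PiM_I_finite) auto
  have "measure (PiM I (\<lambda>_. Q)) ?E = (\<Prod>i\<in>I. measure Q (?X i))"
    unfolding E using A by (intro P.prob_times) auto
  also have "\<dots> = (\<Prod>i\<in>I. if i \<in> B then measure Q A else 1 - measure Q A)"
    using A by (intro prod.cong) (auto simp: prob_compl)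
  also have "\<dots> = measure Q A ^ card B * (1 - measure Q A) ^ card (I - B)"
    using B I by (simp add: prod.If_cases Int_absorb1 Diff_eq)
  finally show "measure (PiM I (\<lambda>_. Q)) ?E
      = measure Q A ^ card B * (1 - measure Q A) ^ (card I - card B)"
    using B I by (simp add: card_Diff_subset finite_subset)
qed

lemma prob_count_PiM:
  assumes "prob_space Q" and A: "A \<in> sets Q" and I: "finite I"
  shows "{x \<in> space (PiM I (\<lambda>_. Q)). R (card {i\<in>I. x i \<in> A})} \<in> sets (PiM I (\<lambda>_. Q))" (is "?E \<in> _")
    and "measure (PiM I (\<lambda>_. Q)) {x \<in> space (PiM I (\<lambda>_. Q)). R (card {i\<in>I. x i \<in> A})}
      = (\<Sum>j\<le>card I. if R j then binom_weight (card I) (measure Q A) j else 0)"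
proof -
  interpret prob_space Q by fact
  interpret P: finite_product_prob_space "\<lambda>_. Q" I
    by standard (rule I)
  let ?F = "\<lambda>B. {x \<in> space (PiM I (\<lambda>_. Q)). {i\<in>I. x i \<in> A} = B}"
  let ?S = "{B \<in> Pow I. R (card B)}"
  have S: "finite ?S" using I by simp
  have E: "?E = (\<Union>B\<in>?S. ?F B)" by auto
  have F: "?F B \<in> sets (PiM I (\<lambda>_. Q))" if "B \<in> ?S" for B
    using prob_hit_set_PiM(1)[OF assms] that by auto
  show "?E \<in> sets (PiM I (\<lambda>_. Q))" unfolding E using F S by blast
  have "measure (PiM I (\<lambda>_. Q)) ?E = (\<Sum>B\<in>?S. measure (PiM I (\<lambda>_. Q)) (?F B))"
    unfolding E using F by (intro P.finite_measure_finite_Union S) (auto simp: disjoint_family_on_def)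
  also have "\<dots> = (\<Sum>B\<in>?S. measure Q A ^ card B * (1 - measure Q A) ^ (card I - card B))"
    by (intro sum.cong prob_hit_set_PiM(2)[OF assms]) auto
  also have "\<dots> = (\<Sum>B\<in>Pow I. if R (card B) then measure Q A ^ card B * (1 - measure Q A) ^ (card I - card B) else 0)"
    using I by (intro sum.inter_filter) simp
  also have "\<dots> = (\<Sum>j\<le>card I. real (card I choose j) *
      (if R j then measure Q A ^ j * (1 - measure Q A) ^ (card I - j) else 0))"
    by (rule sum_Pow_card[OF I])
  also have "\<dots> = (\<Sum>j\<le>card I. if R j then binom_weight (card I) (measure Q A) j else 0)"
    by (intro sum.cong) (auto simp: binom_weight_def)
  finally show "measure (PiM I (\<lambda>_. Q)) ?E
      = (\<Sum>j\<le>card I. if R j then binom_weight (card I) (measure Q A) j else 0)" .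
qed

text \<open>An atom of mass a would place all m scores on the same value with probability a^m > 0,
  which is a tie as soon as m \<ge> 2.\<close>

lemma no_atom_of_distinct:
  assumes "prob_space Q" and f: "f \<in> borel_measurable Q"
    and ks: "distinct ks" "length ks \<ge> 2"
    and dist: "AE x in PiM (set ks) (\<lambda>_. Q). distinct (map (\<lambda>i. f (x i)) ks)"
  shows "measure Q {y \<in> space Q. f y = (t::real)} = 0"
proof -
  interpret prob_space Q by fact
  interpret P: finite_product_prob_space "\<lambda>_. Q" "set ks"
    by standard simp
  let ?A = "{y \<in> space Q. f y = t}"
  let ?E = "{x \<in> space (PiM (set ks) (\<lambda>_. Q)). {i\<in>set ks. x i \<in> ?A} = set ks}"
  have A: "?A \<in> sets Q" using f by measurable
  have "AE x in PiM (set ks) (\<lambda>_. Q). x \<notin> ?E"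
    using dist
  proof eventually_elim
    case (elim x)
    have len: "0 < length ks" "1 < length ks" using ks(2) by linarith+
    have "ks ! 0 \<noteq> ks ! 1" using nth_eq_iff_index_eq[OF ks(1) len] by simp
    moreover have "ks ! 0 \<in> set ks" "ks ! 1 \<in> set ks" using ks by (auto intro!: nth_mem)
    moreover have "f (x (ks ! 0)) \<noteq> f (x (ks ! 1))"
      using elim calculation unfolding distinct_map inj_on_def by metis
    moreover have "\<forall>i\<in>set ks. f (x i) = t" if "x \<in> ?E" using that by blast
    ultimately show ?case by metis
  qed
  then have "measure (PiM (set ks) (\<lambda>_. Q)) ?E = 0"
    using prob_hit_set_PiM(1)[OF assms(1) A, of "set ks" "set ks"] 
    by (subst P.prob_eq_0) auto
  then show ?thesis
    using prob_hit_set_PiM(2)[OF assms(1) A, of "set ks" "set ks"] by simp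
qed

text \<open>Without atoms the c.d.f. is continuous, so the level 1 - \<epsilon> is attained exactly.
  Taking the least such point gives the second property, which converts small miscoverage at
  \<open>t\<close> into a lower bound on \<open>t\<close>.\<close>

lemma no_atom_upper_quantile:
  assumes "prob_space Q" and f: "f \<in> borel_measurable Q"
    and na: "\<And>t. measure Q {y \<in> space Q. f y = t} = 0" and \<epsilon>: "\<epsilon> \<in> {0<..<1}"
  obtains t0 :: real where "measure Q {y \<in> space Q. t0 \<le> f y} = \<epsilon>"
    "\<And>t. measure Q {y \<in> space Q. t < f y} \<le> \<epsilon> \<Longrightarrow> t0 \<le> t"
proof -
  interpret prob_space Q by fact
  let ?N = "distr Q borel f"
  interpret N: real_distribution ?N using f by (intro real_distribution_distr)
  have cdf: "cdf ?N t = measure Q {y \<in> space Q. f y \<le> t}" for t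
    using f by (simp add: cdf_def measure_distr vimage_def Int_def conj_commute)
  have gt: "measure Q {y \<in> space Q. t < f y} = 1 - cdf ?N t" for t
  proof -
    have "{y \<in> space Q. t < f y} = space Q - {y \<in> space Q. f y \<le> t}" by auto
    then show ?thesis using f by (simp add: cdf prob_compl)
  qed
  have cont: "isCont (cdf ?N) t" for t
    using f na[of t] by (simp add: N.isCont_cdf measure_distr vimage_def Int_def conj_commute)
  have "eventually (\<lambda>x. cdf ?N x > 1 - \<epsilon>) at_top"
    using N.cdf_lim_at_top_prob \<epsilon> by (auto elim!: order_tendstoD(1))
  then obtain b where b: "cdf ?N b > 1 - \<epsilon>" by (auto simp: eventually_at_top_linorder)
  have "eventually (\<lambda>x. cdf ?N x < 1 - \<epsilon>) at_bot"
    using N.cdf_lim_at_bot \<epsilon> by (auto elim!: order_tendstoD(2))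
  then obtain a where a: "\<And>x. x \<le> a \<Longrightarrow> cdf ?N x < 1 - \<epsilon>" by (auto simp: eventually_at_bot_linorder)
  have "a \<le> b" using a[of b] b by linarith
  then obtain u where u: "cdf ?N u = 1 - \<epsilon>"
    using IVT[of "cdf ?N" a "1-\<epsilon>" b] a[of a] b cont by auto
  let ?A = "{t. cdf ?N t \<ge> 1 - \<epsilon>}"
  define t0 where "t0 = Inf ?A"
  have bdd: "bdd_below ?A"
    by (rule bdd_belowI[of _ a]) (metis a linorder_not_le mem_Collect_eq nle_le)
  \<comment> \<open>Continuity makes \<open>?A\<close> closed, so the infimum belongs to it. The
    point \<open>u\<close> from the intermediate value theorem lies above the infimum and caps the
    c.d.f. there, which leaves exactly 1 - \<epsilon>.\<close>
  have "closed ?A" using cont by (intro closed_Collect_le continuous_intros continuous_at_imp_continuous_on) auto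
  then have "t0 \<in> ?A" unfolding t0_def using u bdd by (intro closed_contains_Inf) (auto intro!: exI[of _ u])
  moreover have "t0 \<le> u" unfolding t0_def using u bdd by (intro cInf_lower) auto
  ultimately have t0: "cdf ?N t0 = 1 - \<epsilon>" using N.cdf_nondecreasing[of t0 u] u by auto
  have "{y \<in> space Q. t0 \<le> f y} = {y \<in> space Q. t0 < f y} \<union> {y \<in> space Q. f y = t0}" by auto
  then have "measure Q {y \<in> space Q. t0 \<le> f y} = measure Q {y \<in> space Q. t0 < f y} + measure Q {y \<in> space Q. f y = t0}"
    using f by (subst finite_measure_Union[symmetric]) auto
  then have "measure Q {y \<in> space Q. t0 \<le> f y} = \<epsilon>" using na gt t0 by simp
  moreover have "t0 \<le> t" if "measure Q {y \<in> space Q. t < f y} \<le> \<epsilon>" for t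
    unfolding t0_def using that bdd by (intro cInf_lower) (auto simp: gt)
  ultimately show ?thesis by (rule that)
qed

lemma calibration_coverage_upper_bound:
  assumes Q: "prob_space Q" and f: "f \<in> borel_measurable Q"
    and \<epsilon>: "\<epsilon> \<in> {0<..<1}" and \<delta>: "\<delta> \<in> {0<..<1}"
    and ks: "distinct ks" "ks \<noteq> []"
    and dist: "AE x in PiM (set ks) (\<lambda>_. Q). distinct (map (\<lambda>i. f (x i)) ks)"
  shows "measure (PiM (set ks) (\<lambda>_. Q)) {x \<in> space (PiM (set ks) (\<lambda>_. Q)).
      measure Q {y \<in> space Q. threshold \<epsilon> \<delta> (map (\<lambda>i. f (x i)) ks) < ereal (f y)} \<le> \<epsilon>}
    \<le> 1 - \<delta> + 1 / sqrt (2 * real (length ks) * \<epsilon> * (1 - \<epsilon>))" (is "measure ?P ?E \<le> 1 - \<delta> + ?c")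
proof -
  interpret prob_space Q by fact
  interpret P: finite_product_prob_space "\<lambda>_. Q" "set ks"
    by standard simp
  define m where "m = length ks"
  define k where "k = kidx m \<epsilon> \<delta>"
  have m: "m > 0" and card: "card (set ks) = m" using ks by (auto simp: m_def distinct_card)
  note kp = kidx_props[OF \<epsilon> \<delta> m, folded k_def]
  have "0 < \<epsilon> * (1 - \<epsilon>)" using \<epsilon> by simp
  have bw: "binom_weight m \<epsilon> (nat (k+1)) \<le> ?c"
    using binom_weight_le[of \<epsilon> "nat (k+1)" m] \<epsilon> m kp(1) by (auto simp: m_def)
  show ?thesis
  proof (cases "m = 1")
    case True
    \<comment> \<open>A single score never ties, so nothing can be inferred about atoms. But 2
      \<epsilon> (1 - \<epsilon>) \<le> 1/2 makes the error term at least 1.\<close>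
    have "\<epsilon> * (1 - \<epsilon>) \<le> 1/4" using zero_le_power2[of "\<epsilon> - 1/2"] by (simp add: power2_eq_square algebra_simps)
    then have "sqrt (2 * real (length ks) * \<epsilon> * (1 - \<epsilon>)) \<le> sqrt 1"
      using True by (intro real_sqrt_le_mono) (simp add: m_def)
    then have "1 \<le> ?c" using \<open>0 < \<epsilon> * (1 - \<epsilon>)\<close> True by (simp add: m_def)
    then show ?thesis using P.prob_le_1[of ?E] \<delta> by (auto intro: order_trans)
  next
    case False
    then have "length ks \<ge> 2" using m unfolding m_def by linarith
    then have na: "measure Q {y \<in> space Q. f y = t} = 0" for t
      by (rule no_atom_of_distinct[OF Q f ks(1) _ dist])
    obtain t0 where t0: "measure Q {y \<in> space Q. t0 \<le> f y} = \<epsilon>"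
      "\<And>t. measure Q {y \<in> space Q. t < f y} \<le> \<epsilon> \<Longrightarrow> t0 \<le> t"
      using no_atom_upper_quantile[OF Q f na \<epsilon>] by metis
    let ?A = "{y \<in> space Q. t0 \<le> f y}"
    have A: "?A \<in> sets Q" using f by measurable
    let ?F = "{x \<in> space ?P. int (card {i\<in>set ks. x i \<in> ?A}) > k}"
    have "?E \<subseteq> ?F"
    proof safe
      fix x assume x: "x \<in> space ?P"
        "measure Q {y \<in> space Q. threshold \<epsilon> \<delta> (map (\<lambda>i. f (x i)) ks) < ereal (f y)} \<le> \<epsilon>"
      \<comment> \<open>For k = -1 every count exceeds k. Otherwise the threshold is the finite
        order statistic number j = m - k, stored at list position j - 1. If it is at least
        \<open>t0\<close>, at most j - 1 scores lie below \<open>t0\<close>, so at least m - j + 1 =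
        k + 1 do not.\<close>
      show "k < int (card {i\<in>set ks. x i \<in> ?A})"
      proof (cases "k = -1")
        case False
        let ?xs = "map (\<lambda>i. f (x i)) ks"
        define j where "j = nat (int m - k)"
        have j: "1 \<le> j" "j \<le> m" "int j = int m - k" using kp(1) False by (auto simp: j_def)
        have "threshold \<epsilon> \<delta> ?xs = ereal (sort ?xs ! (j - 1))"
          using j by (simp add: threshold_def order_stat_def m_def[symmetric] k_def[symmetric] j_def[symmetric])
        then have "t0 \<le> sort ?xs ! (j - 1)" using x(2) t0(2) by simp
        then have "\<not> j - 1 < length (filter (\<lambda>y. y < t0) ?xs)"
          using sort_nth_iff_filter[of "\<lambda>y. y < t0" "j-1" ?xs] j by (auto simp: m_def)
        then have "length (filter (\<lambda>y. y < t0) ?xs) < j" using j by linarith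
        moreover have "length (filter (\<lambda>y. y < t0) ?xs) + length (filter (\<lambda>y. \<not> y < t0) ?xs) = m"
          using sum_length_filter_compl[of "\<lambda>y. y < t0" ?xs] by (simp add: m_def)
        moreover have "length (filter (\<lambda>y. \<not> y < t0) ?xs) = card {i\<in>set ks. x i \<in> ?A}"
        proof -
          have "length (filter (\<lambda>y. \<not> y < t0) ?xs) = length (filter (\<lambda>i. \<not> f (x i) < t0) ks)"
            by (simp add: filter_map o_def)
          also have "\<dots> = card {i\<in>set ks. \<not> f (x i) < t0}"
            using ks by (simp add: distinct_length_filter Int_def conj_commute)
          also have "{i\<in>set ks. \<not> f (x i) < t0} = {i\<in>set ks. x i \<in> ?A}"
            using x(1) by (auto simp: space_PiM PiE_iff)
          finally show ?thesis .
        qed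
        ultimately show ?thesis using j by linarith
      qed auto
    qed
    then have "measure ?P ?E \<le> measure ?P ?F"
      using prob_count_PiM(1)[OF Q A, of "set ks"] by (intro P.finite_measure_mono) auto
    also have "\<dots> = (\<Sum>j\<le>m. if int j > k then binom_weight m \<epsilon> j else 0)"
      using prob_count_PiM(2)[OF Q A finite_set[of ks], where R = "\<lambda>j. int j > k"] unfolding t0(1) card .
    also have "\<dots> \<le> 1 - \<delta> + ?c" using kp(2) bw by simp
    finally show ?thesis .
  qed
qed

section \<open>Splitting into training and calibration data\<close>

text \<open>A sublevel set of an order statistic is a condition on how many entries are at most
  \<open>a\<close>; this count is measurable by induction on the list.\<close>

lemma measurable_sort_nth:
  fixes g :: "'x \<Rightarrow> 'i \<Rightarrow> real"
  assumes "\<And>i. i \<in> set ks \<Longrightarrow> (\<lambda>x. g x i) \<in> borel_measurable N" "j < length ks"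
  shows "(\<lambda>x. sort (map (g x) ks) ! j) \<in> borel_measurable N"
proof (rule borel_measurable_iff_le[THEN iffD2], rule allI)
  fix a :: real
  have "(\<lambda>x. length (filter (\<lambda>y. y \<le> a) (map (g x) ks))) \<in> N \<rightarrow>\<^sub>M count_space UNIV"
    using assms(1)
  proof (induction ks)
    case (Cons k ks)
    have [measurable]: "(\<lambda>x. g x k) \<in> borel_measurable N"
      "(\<lambda>x. length (filter (\<lambda>y. y \<le> a) (map (g x) ks))) \<in> N \<rightarrow>\<^sub>M count_space UNIV"
      using Cons by auto
    have "(\<lambda>x. length (filter (\<lambda>y. y \<le> a) (map (g x) (k # ks))))
      = (\<lambda>x. if g x k \<le> a then Suc (length (filter (\<lambda>y. y \<le> a) (map (g x) ks)))
             else length (filter (\<lambda>y. y \<le> a) (map (g x) ks)))" by auto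
    then show ?case by (simp only:) measurable
  qed simp
  then have [measurable]: "(\<lambda>x. length (filter (\<lambda>y. y \<le> a) (map (g x) ks))) \<in> N \<rightarrow>\<^sub>M count_space UNIV" .
  have "{x \<in> space N. sort (map (g x) ks) ! j \<le> a}
      = {x \<in> space N. j < length (filter (\<lambda>y. y \<le> a) (map (g x) ks))}"
    using assms(2) by (subst sort_nth_iff_filter[of "\<lambda>y. y \<le> a" j]) auto
  also have "\<dots> \<in> sets N" by measurable
  finally show "{x \<in> space N. sort (map (g x) ks) ! j \<le> a} \<in> sets N" .
qed

lemma measurable_threshold:
  fixes g :: "'x \<Rightarrow> 'i \<Rightarrow> real"
  assumes g: "\<And>i. i \<in> set ks \<Longrightarrow> (\<lambda>x. g x i) \<in> borel_measurable N"
  shows "(\<lambda>x. threshold \<epsilon> \<delta> (map (g x) ks)) \<in> borel_measurable N"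
proof (cases "ks = []")
  case False
  define j where "j = nat (int (length ks) - kidx (length ks) \<epsilon> \<delta>)"
  show ?thesis
  proof (cases "j \<le> length ks")
    case True
    have "j - 1 < length ks" using True False by (cases ks) auto
    then have "(\<lambda>x. sort (map (g x) ks) ! (j - 1)) \<in> borel_measurable N"
      by (intro measurable_sort_nth g)
    then show ?thesis using True by (simp add: threshold_def order_stat_def flip: j_def)
  qed (simp add: threshold_def order_stat_def flip: j_def)
qed simp

lemma measurable_pred_distinct:
  fixes g :: "'x \<Rightarrow> 'i \<Rightarrow> real"
  assumes "\<And>i. i \<in> set ks \<Longrightarrow> (\<lambda>x. g x i) \<in> borel_measurable N"
  shows "Measurable.pred N (\<lambda>x. distinct (map (g x) ks))"
  using assms
proof (induction ks)
  case (Cons k ks)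
  have [measurable]: "(\<lambda>x. g x k) \<in> borel_measurable N"
      "Measurable.pred N (\<lambda>x. distinct (map (g x) ks))"
      "\<And>i. i \<in> set ks \<Longrightarrow> (\<lambda>x. g x i) \<in> borel_measurable N"
    using Cons by auto
  have "(\<lambda>x. distinct (map (g x) (k # ks)))
     = (\<lambda>x. (\<forall>i\<in>set ks. g x k \<noteq> g x i) \<and> distinct (map (g x) ks))"
    by (auto simp: fun_eq_iff)
  moreover have "Measurable.pred N (\<lambda>x. (\<forall>i\<in>set ks. g x k \<noteq> g x i) \<and> distinct (map (g x) ks))"
    by (intro pred_intros_logic pred_intros_finite) measurable
  ultimately show ?case by simp
qed simp

text \<open>The miscoverage of the band with score \<open>f\<close> and threshold \<open>t\<close>,
  as a functional of the law of the test pair. An infinite threshold gives 0.\<close>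

definition excess_prob :: "'y measure \<Rightarrow> ('y \<Rightarrow> real) \<Rightarrow> ereal \<Rightarrow> real" where
  "excess_prob Q f t = measure Q {y \<in> space Q. t < ereal (f y)}"

lemma measurable_excess_prob:
  assumes "prob_space Q" and [measurable]: "(\<lambda>(x, y). F x y) \<in> borel_measurable (N \<Otimes>\<^sub>M Q)"
    and [measurable]: "t \<in> borel_measurable N"
  shows "(\<lambda>x. excess_prob Q (F x) (t x)) \<in> borel_measurable N"
proof -
  interpret prob_space Q by fact
  let ?A = "{z \<in> space (N \<Otimes>\<^sub>M Q). t (fst z) < ereal (F (fst z) (snd z))}"
  have [measurable]: "(\<lambda>z. F (fst z) (snd z)) \<in> borel_measurable (N \<Otimes>\<^sub>M Q)"
    using assms(2) by (simp add: split_beta')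
  have "?A \<in> sets (N \<Otimes>\<^sub>M Q)" by measurable
  then have m: "(\<lambda>x. measure Q (Pair x -` ?A)) \<in> borel_measurable N"
    unfolding measure_def by (intro borel_measurable_enn2real measurable_emeasure_Pair)
  have "measure Q (Pair x -` ?A) = excess_prob Q (F x) (t x)" if "x \<in> space N" for x
    using that unfolding excess_prob_def by (intro arg_cong[of _ _ "measure Q"]) (auto simp: space_pair_measure)
  then show ?thesis using m by (subst measurable_cong[of N _ "\<lambda>x. measure Q (Pair x -` ?A)"]) auto
qed

text \<open>Tonelli over the training coordinates \<open>T\<close>: once they are frozen, the score
  is a fixed function and the remaining coordinates form an i.i.d. sample. Feeding \<open>F\<close>
  only \<open>restrict x T\<close> expresses that the score depends on training data alone.\<close>

lemma split_conformal_coverage_upper_bound: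
  assumes Q: "prob_space Q" and \<epsilon>: "\<epsilon> \<in> {0<..<1}" and \<delta>: "\<delta> \<in> {0<..<1}"
    and ks: "distinct ks" "ks \<noteq> []" and T: "finite T" "T \<inter> set ks = {}"
    and F: "(\<lambda>(x, y). F x y) \<in> borel_measurable (PiM T (\<lambda>_. Q) \<Otimes>\<^sub>M Q)"
    and dist: "AE x in PiM (T \<union> set ks) (\<lambda>_. Q). distinct (map (\<lambda>i. F (restrict x T) (x i)) ks)"
  shows "measure (PiM (T \<union> set ks) (\<lambda>_. Q)) {x \<in> space (PiM (T \<union> set ks) (\<lambda>_. Q)).
      excess_prob Q (F (restrict x T)) (threshold \<epsilon> \<delta> (map (\<lambda>i. F (restrict x T) (x i)) ks)) \<le> \<epsilon>}
    \<le> 1 - \<delta> + 1 / sqrt (2 * real (length ks) * \<epsilon> * (1 - \<epsilon>))" (is "measure ?P ?E \<le> ?c")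
proof -
  interpret prob_space Q by fact
  let ?K = "set ks"
  interpret PQ: product_sigma_finite "\<lambda>_. Q" by standard
  interpret T: finite_product_prob_space "\<lambda>_. Q" T by standard (rule T(1))
  interpret K: finite_product_prob_space "\<lambda>_. Q" ?K by standard simp
  interpret TK: finite_product_prob_space "\<lambda>_. Q" "T \<union> ?K" by standard (use T in simp)
  interpret pair: pair_prob_space "PiM T (\<lambda>_. Q)" "PiM ?K (\<lambda>_. Q)" by standard
  have c: "?c \<ge> 0" using \<epsilon> \<delta> by simp
  have [measurable]: "(\<lambda>x. restrict x T) \<in> PiM (T \<union> ?K) (\<lambda>_. Q) \<rightarrow>\<^sub>M PiM T (\<lambda>_. Q)"
    by (rule measurable_restrict_subset) auto
  have g: "(\<lambda>x. F (restrict x T) (x i)) \<in> borel_measurable ?P" if "i \<in> ?K" for i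
  proof -
    have "(\<lambda>x. (restrict x T, x i)) \<in> ?P \<rightarrow>\<^sub>M PiM T (\<lambda>_. Q) \<Otimes>\<^sub>M Q"
      using that by (intro measurable_Pair measurable_component_singleton) auto
    from measurable_comp[OF this F] show ?thesis by (simp add: o_def)
  qed
  have F': "(\<lambda>(x, y). F (restrict x T) y) \<in> borel_measurable (?P \<Otimes>\<^sub>M Q)"
  proof -
    have "(\<lambda>(x, y). (restrict x T, y)) \<in> ?P \<Otimes>\<^sub>M Q \<rightarrow>\<^sub>M PiM T (\<lambda>_. Q) \<Otimes>\<^sub>M Q" by measurable
    from measurable_comp[OF this F] show ?thesis by (simp add: o_def split_beta')
  qed
  let ?t = "\<lambda>x. threshold \<epsilon> \<delta> (map (\<lambda>i. F (restrict x T) (x i)) ks)"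
  have [measurable]: "?t \<in> borel_measurable ?P" by (intro measurable_threshold g)
  have [measurable]: "(\<lambda>x. excess_prob Q (F (restrict x T)) (?t x)) \<in> borel_measurable ?P"
    by (intro measurable_excess_prob Q F') measurable
  have E: "?E \<in> sets ?P" by measurable
  have merge: "distr (PiM T (\<lambda>_. Q) \<Otimes>\<^sub>M PiM ?K (\<lambda>_. Q)) ?P (merge T ?K) = ?P"
    using T by (intro PQ.distr_merge) auto
  have mg: "restrict (merge T ?K (x, y)) T = x" "i \<in> ?K \<Longrightarrow> merge T ?K (x, y) i = y i"
    if "x \<in> space (PiM T (\<lambda>_. Q))" for x i and y :: "'b \<Rightarrow> 'a"
    using that T by (auto simp: merge_def space_PiM PiE_def extensional_def restrict_def fun_eq_iff)
  \<comment> \<open>Absence of ties under the joint law becomes absence of ties for almost every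
    frozen training sample, which is the hypothesis of the bound for a fixed score.\<close>
  have "AE z in PiM T (\<lambda>_. Q) \<Otimes>\<^sub>M PiM ?K (\<lambda>_. Q).
      distinct (map (\<lambda>i. F (restrict (merge T ?K z) T) (merge T ?K z i)) ks)"
    by (rule AE_distrD[OF measurable_merge]) (simp only: merge dist)
  then have "AE x in PiM T (\<lambda>_. Q). AE y in PiM ?K (\<lambda>_. Q).
      distinct (map (\<lambda>i. F (restrict (merge T ?K (x, y)) T) (merge T ?K (x, y) i)) ks)"
    by (rule pair.AE_pair)
  then have bound: "AE x in PiM T (\<lambda>_. Q). emeasure (PiM ?K (\<lambda>_. Q)) (Pair x -` (merge T ?K -` ?E \<inter> space (PiM T (\<lambda>_. Q) \<Otimes>\<^sub>M PiM ?K (\<lambda>_. Q)))) \<le> ennreal ?c"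
  proof (eventually_elim)
    case (elim x)
    show ?case
    proof (cases "x \<in> space (PiM T (\<lambda>_. Q))")
      case True
      have "F x \<in> borel_measurable Q"
        using measurable_Pair2[OF F True] by simp
      moreover have "AE y in PiM ?K (\<lambda>_. Q). distinct (map (\<lambda>i. F x (y i)) ks)"
        using elim mg[OF True] by (simp cong: map_cong)
      ultimately have "measure (PiM ?K (\<lambda>_. Q)) {y \<in> space (PiM ?K (\<lambda>_. Q)).
          measure Q {z \<in> space Q. threshold \<epsilon> \<delta> (map (\<lambda>i. F x (y i)) ks) < ereal (F x z)} \<le> \<epsilon>} \<le> ?c"
        by (intro calibration_coverage_upper_bound Q \<epsilon> \<delta> ks)
      also have "{y \<in> space (PiM ?K (\<lambda>_. Q)).
          measure Q {z \<in> space Q. threshold \<epsilon> \<delta> (map (\<lambda>i. F x (y i)) ks) < ereal (F x z)} \<le> \<epsilon>}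
        = Pair x -` (merge T ?K -` ?E \<inter> space (PiM T (\<lambda>_. Q) \<Otimes>\<^sub>M PiM ?K (\<lambda>_. Q)))"
        using True measurable_space[OF measurable_merge, of _ T "\<lambda>_. Q" ?K] mg[OF True]
        by (auto simp: space_pair_measure excess_prob_def cong: map_cong)
      finally show ?thesis by (subst K.emeasure_eq_measure) (rule ennreal_leI)
    next
      case False
      then show ?thesis by (auto simp: space_pair_measure vimage_def)
    qed
  qed
  have "emeasure ?P ?E = emeasure (PiM T (\<lambda>_. Q) \<Otimes>\<^sub>M PiM ?K (\<lambda>_. Q)) (merge T ?K -` ?E \<inter> space (PiM T (\<lambda>_. Q) \<Otimes>\<^sub>M PiM ?K (\<lambda>_. Q)))"
    using E by (subst merge[symmetric], subst emeasure_distr) auto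
  also have "\<dots> = (\<integral>\<^sup>+x. emeasure (PiM ?K (\<lambda>_. Q)) (Pair x -` (merge T ?K -` ?E \<inter> space (PiM T (\<lambda>_. Q) \<Otimes>\<^sub>M PiM ?K (\<lambda>_. Q)))) \<partial>PiM T (\<lambda>_. Q))"
    using E by (intro K.emeasure_pair_measure_alt) (rule measurable_sets[OF measurable_merge], simp)
  also have "\<dots> \<le> (\<integral>\<^sup>+x. ennreal ?c \<partial>PiM T (\<lambda>_. Q))"
    by (rule nn_integral_mono_AE[OF bound])
  also have "\<dots> = ennreal ?c" by (simp add: T.emeasure_space_1)
  finally show ?thesis using c by (simp add: TK.emeasure_eq_measure)
qed

section \<open>The miscoverage and the data law\<close>

lemma indep_elements_joint_law:
  assumes "prob_space M" and ind: "indep_elements M N X K Y"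
  shows "distr M (N \<Otimes>\<^sub>M K) (\<lambda>\<omega>. (X \<omega>, Y \<omega>)) = distr M N X \<Otimes>\<^sub>M distr M K Y"
proof -
  interpret prob_space M by fact
  have X[measurable]: "X \<in> M \<rightarrow>\<^sub>M N" and Y[measurable]: "Y \<in> M \<rightarrow>\<^sub>M K"
    and I: "indep_set {X -` A \<inter> space M | A. A \<in> sets N} {Y -` A \<inter> space M | A. A \<in> sets K}"
    using ind by (auto simp: indep_elements_def)
  interpret X: prob_space "distr M N X" by (rule prob_space_distr[OF X])
  interpret Y: prob_space "distr M K Y" by (rule prob_space_distr[OF Y])
  show ?thesis
  proof (rule pair_measure_eqI[symmetric])
    fix A B assume A: "A \<in> sets (distr M N X)" and B: "B \<in> sets (distr M K Y)"
    have "emeasure (distr M (N \<Otimes>\<^sub>M K) (\<lambda>\<omega>. (X \<omega>, Y \<omega>))) (A \<times> B)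
        = emeasure M ((X -` A \<inter> space M) \<inter> (Y -` B \<inter> space M))"
      using A B by (subst emeasure_distr) (auto intro!: arg_cong[of _ _ "emeasure M"])
    also have "\<dots> = ennreal (prob (X -` A \<inter> space M) * prob (Y -` B \<inter> space M))"
      unfolding emeasure_eq_measure using A B by (subst indep_setD[OF I]) auto
    also have "\<dots> = emeasure (distr M N X) A * emeasure (distr M K Y) B"
      using A B by (simp add: emeasure_distr emeasure_eq_measure ennreal_mult)
    finally show "emeasure (distr M N X) A * emeasure (distr M K Y) B
      = emeasure (distr M (N \<Otimes>\<^sub>M K) (\<lambda>\<omega>. (X \<omega>, Y \<omega>))) (A \<times> B)" ..
  qed (auto intro: X.sigma_finite_measure_axioms Y.sigma_finite_measure_axioms)
qed

text \<open>For an independent pair, conditioning on \<open>X\<close> amounts to freezing it, so the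
  conditional probability is the measure of the section of \<open>G\<close> at \<open>X\<close>. The
  set \<open>G\<close> is separate from \<open>I\<close> because sections need a jointly measurable
  set, while \<open>I\<close> is merely a family of sets.\<close>

lemma miscoverage_eq:
  assumes "prob_space M"
    and ind: "indep_elements M N X K (\<lambda>\<omega>. (s \<omega>, y \<omega>))"
    and G[measurable]: "G \<in> sets (N \<Otimes>\<^sub>M K)"
    and IG: "\<And>\<omega>. \<omega> \<in> space M \<Longrightarrow> y \<omega> \<notin> I \<omega> (s \<omega>) \<longleftrightarrow> (X \<omega>, s \<omega>, y \<omega>) \<in> G"
  shows "AE \<omega> in M. miscoverage M N X I s y \<omega>
    = measure (distr M K (\<lambda>\<omega>. (s \<omega>, y \<omega>))) (Pair (X \<omega>) -` G)"
proof -
  interpret prob_space M by fact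
  let ?Y = "\<lambda>\<omega>. (s \<omega>, y \<omega>)"
  let ?Q = "distr M K ?Y"
  let ?F = "vimage_algebra (space M) X N"
  let ?f = "indicator {\<omega> \<in> space M. y \<omega> \<notin> I \<omega> (s \<omega>)} :: _ \<Rightarrow> real"
  let ?g = "\<lambda>\<omega>. measure ?Q (Pair (X \<omega>) -` G)"
  have X[measurable]: "X \<in> M \<rightarrow>\<^sub>M N" and Y[measurable]: "?Y \<in> M \<rightarrow>\<^sub>M K"
    using ind by (auto simp: indep_elements_def)
  interpret Q: prob_space ?Q by (rule prob_space_distr[OF Y])
  have XF: "X \<in> ?F \<rightarrow>\<^sub>M N"
    by (rule measurable_vimage_algebra1) (use measurable_space[OF X] in auto)
  have setsF: "sets ?F = {X -` A \<inter> space M | A. A \<in> sets N}"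
    by (rule sets_vimage_algebra2) (use measurable_space[OF X] in auto)
  have sub: "subalgebra M ?F"
    unfolding subalgebra_def setsF by auto
  interpret finite_measure_subalgebra M ?F
    by standard (rule sub)
  have set_eq: "{\<omega> \<in> space M. y \<omega> \<notin> I \<omega> (s \<omega>)} = (\<lambda>\<omega>. (X \<omega>, ?Y \<omega>)) -` G \<inter> space M"
    using IG by auto
  have ev: "{\<omega> \<in> space M. y \<omega> \<notin> I \<omega> (s \<omega>)} \<in> events"
    unfolding set_eq by measurable
  have gN: "(\<lambda>x. measure ?Q (Pair x -` G)) \<in> borel_measurable N"
    unfolding measure_def using G by (intro borel_measurable_enn2real Q.measurable_emeasure_Pair) simp
  have gF: "?g \<in> borel_measurable ?F" by (rule measurable_compose[OF XF gN])
  have gM[measurable]: "?g \<in> borel_measurable M" by (rule measurable_compose[OF X gN])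
  have "AE \<omega> in M. real_cond_exp M ?F ?f \<omega> = ?g \<omega>"
  proof (rule real_cond_exp_charact)
    fix A assume "A \<in> sets ?F"
    then obtain B where B[measurable]: "B \<in> sets N" and A: "A = X -` B \<inter> space M" by (auto simp: setsF)
    have [measurable]: "A \<in> events" unfolding A by measurable
    have "ennreal (\<integral>\<omega>\<in>A. ?f \<omega> \<partial>M) = ennreal (\<integral>\<omega>. indicator (A \<inter> {\<omega> \<in> space M. y \<omega> \<notin> I \<omega> (s \<omega>)}) \<omega> \<partial>M)"
      by (simp add: set_lebesgue_integral_def indicator_inter_arith)
    also have "\<dots> = emeasure M (A \<inter> {\<omega> \<in> space M. y \<omega> \<notin> I \<omega> (s \<omega>)})"
      using ev by (simp add: emeasure_eq_measure Int_absorb2)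
    \<comment> \<open>An event of the conditioning algebra is a condition \<open>B\<close> on
      \<open>X\<close>. Cutting \<open>G\<close> by \<open>B \<times> space K\<close> turns the
      integral over \<open>A\<close> into one value of the joint law; its sections are either those
      of \<open>G\<close> or empty.\<close>
    also have "A \<inter> {\<omega> \<in> space M. y \<omega> \<notin> I \<omega> (s \<omega>)} = (\<lambda>\<omega>. (X \<omega>, ?Y \<omega>)) -` (G \<inter> (B \<times> space K)) \<inter> space M"
      unfolding set_eq A using measurable_space[OF Y] by auto
    also have "emeasure M \<dots> = emeasure (distr M (N \<Otimes>\<^sub>M K) (\<lambda>\<omega>. (X \<omega>, ?Y \<omega>))) (G \<inter> (B \<times> space K))"
      by (subst emeasure_distr) auto
    also have "\<dots> = (\<integral>\<^sup>+x. emeasure ?Q (Pair x -` (G \<inter> (B \<times> space K))) \<partial>distr M N X)"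
      unfolding indep_elements_joint_law[OF assms(1) ind]
      by (rule Q.emeasure_pair_measure_alt) simp
    also have "\<dots> = (\<integral>\<^sup>+\<omega>. emeasure ?Q (Pair (X \<omega>) -` (G \<inter> (B \<times> space K))) \<partial>M)"
      using Q.measurable_emeasure_Pair[of "G \<inter> (B \<times> space K)" N] by (subst nn_integral_distr) auto
    also have "\<dots> = (\<integral>\<^sup>+\<omega>. ennreal (indicator A \<omega> * ?g \<omega>) \<partial>M)"
    proof (rule nn_integral_cong)
      fix \<omega> assume w: "\<omega> \<in> space M"
      have "Pair (X \<omega>) -` (G \<inter> (B \<times> space K)) = (if \<omega> \<in> A then Pair (X \<omega>) -` G else {})"
        using w sets.sets_into_space[OF G] by (auto simp: A space_pair_measure)
      then show "emeasure ?Q (Pair (X \<omega>) -` (G \<inter> (B \<times> space K))) = ennreal (indicator A \<omega> * ?g \<omega>)"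
        by (simp add: Q.emeasure_eq_measure)
    qed
    also have "\<dots> = ennreal (\<integral>\<omega>\<in>A. ?g \<omega> \<partial>M)"
      unfolding set_lebesgue_integral_def real_scaleR_def
      by (intro nn_integral_eq_integral integrable_const_bound[where B=1]) (auto simp: indicator_def)
    finally show "(\<integral>\<omega>\<in>A. ?f \<omega> \<partial>M) = (\<integral>\<omega>\<in>A. ?g \<omega> \<partial>M)"
      by (subst (asm) ennreal_inj) (auto simp: set_lebesgue_integral_def intro!: integral_nonneg_AE)
  next
    show "integrable M ?f" using ev by (simp add: emeasure_eq_measure)
    show "integrable M ?g" by (intro integrable_const_bound[where B=1]) auto
  qed (rule gF)
  then show ?thesis by (simp add: miscoverage_def)
qed

section \<open>Policies as densities, the data law and the change of measure\<close>

lemma policyD: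
  assumes "policy PS da p"
  shows "(\<lambda>z. p (fst z) (snd z)) \<in> borel_measurable (PS \<Otimes>\<^sub>M da)"
    "\<And>s a. s \<in> space PS \<Longrightarrow> a \<in> space da \<Longrightarrow> 0 \<le> p s a"
    "(\<lambda>s. density da (\<lambda>a. ennreal (p s a))) \<in> PS \<rightarrow>\<^sub>M prob_algebra da"
    "\<And>s. s \<in> space PS \<Longrightarrow> p s \<in> borel_measurable da"
    "\<And>s. s \<in> space PS \<Longrightarrow> (\<integral>\<^sup>+a. ennreal (p s a) \<partial>da) = 1"
proof -
  show 1: "(\<lambda>z. p (fst z) (snd z)) \<in> borel_measurable (PS \<Otimes>\<^sub>M da)"
    "\<And>s a. s \<in> space PS \<Longrightarrow> a \<in> space da \<Longrightarrow> 0 \<le> p s a"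
    "(\<lambda>s. density da (\<lambda>a. ennreal (p s a))) \<in> PS \<rightarrow>\<^sub>M prob_algebra da"
    using assms by (auto simp: policy_def split_beta')
  show 2: "p s \<in> borel_measurable da" if "s \<in> space PS" for s
    using measurable_Pair2[OF 1(1) that] by simp
  show "(\<integral>\<^sup>+a. ennreal (p s a) \<partial>da) = 1" if "s \<in> space PS" for s
  proof -
    have "prob_space (density da (\<lambda>a. ennreal (p s a)))"
      using measurable_space[OF 1(3) that] by (simp add: space_prob_algebra)
    from prob_space.emeasure_space_1[OF this] show ?thesis
      using 2[OF that] by (simp add: emeasure_density cong: nn_integral_cong_simp)
  qed
qed

lemma measurable_data_kernel:
  assumes PR: "PR \<in> PS \<Otimes>\<^sub>M da \<rightarrow>\<^sub>M prob_algebra (borel :: real measure)" and p: "policy PS da p"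
  shows "(\<lambda>(s, a). PR (s, a) \<bind> (\<lambda>r. return (PS \<Otimes>\<^sub>M da \<Otimes>\<^sub>M borel) (s, a, r)))
      \<in> PS \<Otimes>\<^sub>M da \<rightarrow>\<^sub>M prob_algebra (PS \<Otimes>\<^sub>M da \<Otimes>\<^sub>M borel)" (is ?A)
    and "(\<lambda>s. density da (\<lambda>a. ennreal (p s a)) \<bind> (\<lambda>a. PR (s, a) \<bind>
       (\<lambda>r. return (PS \<Otimes>\<^sub>M da \<Otimes>\<^sub>M borel) (s, a, r)))) \<in> PS \<rightarrow>\<^sub>M prob_algebra (PS \<Otimes>\<^sub>M da \<Otimes>\<^sub>M borel)"
proof -
  show A: ?A
    unfolding split_beta'
  proof (rule measurable_bind_prob_space2)
    show "(\<lambda>x. PR (fst x, snd x)) \<in> PS \<Otimes>\<^sub>M da \<rightarrow>\<^sub>M prob_algebra borel" using PR by simp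
    have "(\<lambda>z. (fst (fst z), snd (fst z), snd z)) \<in> (PS \<Otimes>\<^sub>M da) \<Otimes>\<^sub>M borel \<rightarrow>\<^sub>M PS \<Otimes>\<^sub>M da \<Otimes>\<^sub>M (borel :: real measure)"
      by measurable
    from measurable_compose[OF this measurable_return_prob_space]
    show "(\<lambda>(x, y). return (PS \<Otimes>\<^sub>M da \<Otimes>\<^sub>M borel) (fst x, snd x, y)) \<in> (PS \<Otimes>\<^sub>M da) \<Otimes>\<^sub>M borel \<rightarrow>\<^sub>M prob_algebra (PS \<Otimes>\<^sub>M da \<Otimes>\<^sub>M (borel :: real measure))"
      by (simp add: split_beta')
  qed
  show "(\<lambda>s. density da (\<lambda>a. ennreal (p s a)) \<bind> (\<lambda>a. PR (s, a) \<bind>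
       (\<lambda>r. return (PS \<Otimes>\<^sub>M da \<Otimes>\<^sub>M borel) (s, a, r)))) \<in> PS \<rightarrow>\<^sub>M prob_algebra (PS \<Otimes>\<^sub>M da \<Otimes>\<^sub>M borel)"
    by (rule measurable_bind_prob_space2[OF policyD(3)[OF p] A])
qed

lemma nn_integral_data_kernel:
  assumes PR: "PR \<in> PS \<Otimes>\<^sub>M da \<rightarrow>\<^sub>M prob_algebra (borel :: real measure)"
    and p: "policy PS da p" and s: "s \<in> space PS"
    and F[measurable]: "F \<in> borel_measurable (PS \<Otimes>\<^sub>M da \<Otimes>\<^sub>M borel)"
  shows "(\<integral>\<^sup>+z. F z \<partial>(density da (\<lambda>a. ennreal (p s a)) \<bind> (\<lambda>a. PR (s, a) \<bind>
       (\<lambda>r. return (PS \<Otimes>\<^sub>M da \<Otimes>\<^sub>M borel) (s, a, r)))))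
      = (\<integral>\<^sup>+a. ennreal (p s a) * (\<integral>\<^sup>+r. F (s, a, r) \<partial>PR (s, a)) \<partial>da)"
proof -
  let ?L = "PS \<Otimes>\<^sub>M da \<Otimes>\<^sub>M (borel :: real measure)"
  have inner: "(\<integral>\<^sup>+z. F z \<partial>(PR (s, a) \<bind> (\<lambda>r. return ?L (s, a, r)))) = (\<integral>\<^sup>+r. F (s, a, r) \<partial>PR (s, a))"
    if a: "a \<in> space da" for a
  proof -
    have sets: "sets (PR (s, a)) = sets borel"
      using measurable_space[OF PR, of "(s, a)"] s a by (simp add: space_pair_measure space_prob_algebra)
    have m: "(\<lambda>r. (s, a, r)) \<in> borel \<rightarrow>\<^sub>M ?L" using s a by measurable
    have "(\<integral>\<^sup>+z. F z \<partial>(PR (s, a) \<bind> (\<lambda>r. return ?L (s, a, r))))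
      = (\<integral>\<^sup>+r. \<integral>\<^sup>+z. F z \<partial>return ?L (s, a, r) \<partial>PR (s, a))"
      using measurable_compose[OF m return_measurable] sets
      by (intro nn_integral_bind[OF F]) (simp cong: measurable_cong_sets)
    also have "\<dots> = (\<integral>\<^sup>+r. F (s, a, r) \<partial>PR (s, a))"
      using s a F by (intro nn_integral_cong nn_integral_return) (auto simp: space_pair_measure)
    finally show ?thesis .
  qed
  have k1: "(\<lambda>a. PR (s, a) \<bind> (\<lambda>r. return ?L (s, a, r))) \<in> da \<rightarrow>\<^sub>M subprob_algebra ?L"
    using measurable_prob_algebraD[OF measurable_Pair2[OF measurable_data_kernel(1)[OF PR p] s]] by simp
  have "(\<lambda>N. \<integral>\<^sup>+z. F z \<partial>N) \<in> borel_measurable (subprob_algebra ?L)"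
    by (rule nn_integral_measurable_subprob_algebra[OF F])
  from measurable_compose[OF k1 this]
  have Fm: "(\<lambda>a. \<integral>\<^sup>+r. F (s, a, r) \<partial>PR (s, a)) \<in> borel_measurable da"
    using inner by (simp cong: measurable_cong)
  have "(\<integral>\<^sup>+z. F z \<partial>(density da (\<lambda>a. ennreal (p s a)) \<bind> (\<lambda>a. PR (s, a) \<bind> (\<lambda>r. return ?L (s, a, r)))))
      = (\<integral>\<^sup>+a. \<integral>\<^sup>+z. F z \<partial>(PR (s, a) \<bind> (\<lambda>r. return ?L (s, a, r))) \<partial>density da (\<lambda>a. ennreal (p s a)))"
    using k1 by (intro nn_integral_bind[OF F]) (simp cong: measurable_cong_sets)
  also have "\<dots> = (\<integral>\<^sup>+a. \<integral>\<^sup>+r. F (s, a, r) \<partial>PR (s, a) \<partial>density da (\<lambda>a. ennreal (p s a)))"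
    by (intro nn_integral_cong inner) auto
  also have "\<dots> = (\<integral>\<^sup>+a. ennreal (p s a) * (\<integral>\<^sup>+r. F (s, a, r) \<partial>PR (s, a)) \<partial>da)"
    using Fm policyD(4)[OF p s] by (intro nn_integral_density) auto
  finally show ?thesis .
qed

lemma data_law_props:
  assumes PS: "prob_space PS" and PR: "PR \<in> PS \<Otimes>\<^sub>M da \<rightarrow>\<^sub>M prob_algebra (borel :: real measure)"
    and p: "policy PS da p"
  shows sets_data_law: "sets (data_law PS da PR p) = sets (PS \<Otimes>\<^sub>M da \<Otimes>\<^sub>M borel)" (is ?A)
    and prob_space_data_law: "prob_space (data_law PS da PR p)"
    and nn_integral_data_law: "F \<in> borel_measurable (PS \<Otimes>\<^sub>M da \<Otimes>\<^sub>M borel) \<Longrightarrow> (\<integral>\<^sup>+z. F z \<partial>data_law PS da PR p)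
      = (\<integral>\<^sup>+s. \<integral>\<^sup>+a. ennreal (p s a) * (\<integral>\<^sup>+r. F (s, a, r) \<partial>PR (s, a)) \<partial>da \<partial>PS)"
proof -
  note k = measurable_data_kernel(2)[OF PR p]
  have PS': "PS \<in> space (prob_algebra PS)" using PS by (simp add: space_prob_algebra)
  show ?A unfolding data_law_def by (rule sets_bind'[OF PS' k])
  have "(\<lambda>_. PS) \<in> PS \<rightarrow>\<^sub>M prob_algebra PS" using PS' by simp
  note bind = measurable_bind_prob_space[OF this k]
  obtain s0 where "s0 \<in> space PS" using prob_space.not_empty[OF PS] by blast
  from measurable_space[OF bind this] show "prob_space (data_law PS da PR p)"
    unfolding data_law_def by (simp add: space_prob_algebra)
  assume F: "F \<in> borel_measurable (PS \<Otimes>\<^sub>M da \<Otimes>\<^sub>M borel)"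
  show "(\<integral>\<^sup>+z. F z \<partial>data_law PS da PR p)
      = (\<integral>\<^sup>+s. \<integral>\<^sup>+a. ennreal (p s a) * (\<integral>\<^sup>+r. F (s, a, r) \<partial>PR (s, a)) \<partial>da \<partial>PS)"
    unfolding data_law_def nn_integral_bind[OF F measurable_prob_algebraD[OF k]]
    by (intro nn_integral_cong nn_integral_data_kernel[OF PR p _ F])
qed

text \<open>Pointwise the behavior density times weight / B is the target density over B.
  Integrating against the acceptance probability thus replaces the behavior policy by the target
  policy, at the cost of the factor 1 / B.\<close>

lemma nn_integral_data_law_weight:
  assumes PS: "prob_space PS" and PR: "PR \<in> PS \<Otimes>\<^sub>M da \<rightarrow>\<^sub>M prob_algebra (borel :: real measure)"
    and pb: "policy PS da pb" and pe: "policy PS da pe"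
    and B: "B > 0" "\<And>s a. s \<in> space PS \<Longrightarrow> a \<in> space da \<Longrightarrow> pe s a \<le> B * pb s a"
    and H[measurable]: "H \<in> borel_measurable (PS \<Otimes>\<^sub>M da \<Otimes>\<^sub>M borel)"
  shows "(\<integral>\<^sup>+(s, a, r). ennreal (weight pe pb s a / B) * H (s, a, r) \<partial>data_law PS da PR pb)
    = ennreal (1 / B) * (\<integral>\<^sup>+z. H z \<partial>data_law PS da PR pe)"
proof -
  let ?L = "PS \<Otimes>\<^sub>M da \<Otimes>\<^sub>M (borel :: real measure)"
  have [measurable]: "(\<lambda>z. weight pe pb (fst z) (fst (snd z))) \<in> borel_measurable ?L"
    unfolding weight_def
    using measurable_compose[of "\<lambda>z. (fst z, fst (snd z))" ?L "PS \<Otimes>\<^sub>M da" _ borel, OF _ policyD(1)[OF pb]]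
      measurable_compose[of "\<lambda>z. (fst z, fst (snd z))" ?L "PS \<Otimes>\<^sub>M da" _ borel, OF _ policyD(1)[OF pe]]
    by (intro borel_measurable_divide) simp_all
  have pbe: "ennreal (pb s a) * ennreal (weight pe pb s a / B) = ennreal (1 / B) * ennreal (pe s a)"
    if "s \<in> space PS" "a \<in> space da" for s a
  proof -
    have nn: "0 \<le> pb s a" "0 \<le> pe s a" using that policyD(2)[OF pb] policyD(2)[OF pe] by blast+
    \<comment> \<open>If the behavior density is 0, the bound by B forces the target density to be 0
      as well and both sides vanish; otherwise the density cancels.\<close>
    have "pb s a * (weight pe pb s a / B) = 1 / B * pe s a"
      using B(2)[OF that] nn by (cases "pb s a = 0") (auto simp: weight_def)
    then show ?thesis using nn B(1) by (simp flip: ennreal_mult add: weight_def ennreal_mult'')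
  qed
  have HPR: "(\<lambda>a. \<integral>\<^sup>+r. H (s, a, r) \<partial>PR (s, a)) \<in> borel_measurable da" if s: "s \<in> space PS" for s
  proof -
    have "(\<lambda>a. (PR (s, a))) \<in> da \<rightarrow>\<^sub>M subprob_algebra borel"
      using measurable_prob_algebraD[OF PR] s by (rule measurable_Pair2)
    moreover have "(\<lambda>(a, r). H (s, a, r)) \<in> borel_measurable (da \<Otimes>\<^sub>M borel)"
      using s by measurable
    ultimately show ?thesis
      by (intro nn_integral_measurable_subprob_algebra2)
  qed
  have PRsets: "sets (PR (s, a)) = sets borel" if "s \<in> space PS" "a \<in> space da" for s a
    using measurable_space[OF PR, of "(s, a)"] that by (simp add: space_pair_measure space_prob_algebra)
  \<comment> \<open>The measure \<open>da\<close> need not be sigma-finite, so measurability in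
    \<open>s\<close> is not taken from Tonelli over \<open>da\<close> but from the measurable kernel
    that defines the data law.\<close>
  have HPR2: "(\<lambda>s. \<integral>\<^sup>+a. ennreal (pe s a) * (\<integral>\<^sup>+r. H (s, a, r) \<partial>PR (s, a)) \<partial>da) \<in> borel_measurable PS"
    using measurable_compose[OF measurable_prob_algebraD[OF measurable_data_kernel(2)[OF PR pe]]
          nn_integral_measurable_subprob_algebra[OF H]]
    by (simp add: nn_integral_data_kernel[OF PR pe _ H] cong: measurable_cong)
  have "(\<integral>\<^sup>+(s, a, r). ennreal (weight pe pb s a / B) * H (s, a, r) \<partial>data_law PS da PR pb)
    = (\<integral>\<^sup>+s. \<integral>\<^sup>+a. ennreal (pb s a) * (\<integral>\<^sup>+r. ennreal (weight pe pb s a / B) * H (s, a, r) \<partial>PR (s, a)) \<partial>da \<partial>PS)"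
    unfolding split_beta' by (subst data_law_props(3)[OF PS PR pb]) auto
  also have "\<dots> = (\<integral>\<^sup>+s. \<integral>\<^sup>+a. ennreal (1 / B) * (ennreal (pe s a) * (\<integral>\<^sup>+r. H (s, a, r) \<partial>PR (s, a))) \<partial>da \<partial>PS)"
  proof (intro nn_integral_cong)
    fix s a assume s: "s \<in> space PS" and a: "a \<in> space da"
    have "(\<lambda>r. H (s, a, r)) \<in> borel_measurable (PR (s, a))"
      using s a PRsets[OF s a] by (simp cong: measurable_cong_sets)
    then have "ennreal (pb s a) * (\<integral>\<^sup>+r. ennreal (weight pe pb s a / B) * H (s, a, r) \<partial>PR (s, a))
      = ennreal (pb s a) * ennreal (weight pe pb s a / B) * (\<integral>\<^sup>+r. H (s, a, r) \<partial>PR (s, a))"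
      by (simp add: nn_integral_cmult mult.assoc)
    then show "ennreal (pb s a) * (\<integral>\<^sup>+r. ennreal (weight pe pb s a / B) * H (s, a, r) \<partial>PR (s, a))
      = ennreal (1 / B) * (ennreal (pe s a) * (\<integral>\<^sup>+r. H (s, a, r) \<partial>PR (s, a)))"
      unfolding pbe[OF s a] by (simp add: mult.assoc)
  qed
  also have "\<dots> = (\<integral>\<^sup>+s. ennreal (1 / B) * (\<integral>\<^sup>+a. ennreal (pe s a) * (\<integral>\<^sup>+r. H (s, a, r) \<partial>PR (s, a)) \<partial>da) \<partial>PS)"
    using HPR policyD(4)[OF pe] by (intro nn_integral_cong nn_integral_cmult) auto
  also have "\<dots> = ennreal (1 / B) * (\<integral>\<^sup>+s. \<integral>\<^sup>+a. ennreal (pe s a) * (\<integral>\<^sup>+r. H (s, a, r) \<partial>PR (s, a)) \<partial>da \<partial>PS)"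
    by (rule nn_integral_cmult[OF HPR2])
  also have "\<dots> = ennreal (1 / B) * (\<integral>\<^sup>+z. H z \<partial>data_law PS da PR pe)"
    by (subst data_law_props(3)[OF PS PR pe]) auto
  finally show ?thesis .
qed

text \<open>Each constraint is pointwise and closed in \<open>b\<close>, so the infimum is itself
  admissible. It is at least 1 because both densities have total mass one at any fixed
  context.\<close>

lemma ratio_bound_props:
  assumes PS: "prob_space PS" and pb: "policy PS da pb" and pe: "policy PS da pe"
    and fin: "ratio_bound PS da pe pb < \<infinity>"
  shows "real_of_ereal (ratio_bound PS da pe pb) \<ge> 1"
    and "\<And>s a. s \<in> space PS \<Longrightarrow> a \<in> space da \<Longrightarrow> pe s a \<le> real_of_ereal (ratio_bound PS da pe pb) * pb s a"
proof -
  let ?Z = "{b. \<forall>s\<in>space PS. \<forall>a\<in>space da. pe s a \<le> b * pb s a}"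
  have ne: "?Z \<noteq> {}" using fin unfolding ratio_bound_def by (metis image_empty Inf_empty top_ereal_def less_irrefl)
  obtain s0 where s0: "s0 \<in> space PS" using prob_space.not_empty[OF PS] by blast
  have ge1: "1 \<le> b" if b: "b \<in> ?Z" for b
  proof -
    have "1 = (\<integral>\<^sup>+a. ennreal (pe s0 a) \<partial>da)" using policyD(5)[OF pe s0] by simp
    also have "\<dots> \<le> (\<integral>\<^sup>+a. ennreal b * ennreal (pb s0 a) \<partial>da)"
    proof (rule nn_integral_mono)
      fix a assume a: "a \<in> space da"
      have "pe s0 a \<le> b * pb s0 a" using b s0 a by blast
      \<comment> \<open>An admissible \<open>b\<close> is not yet known to be nonnegative, hence the
        detour through the maximum with 0 before passing to extended nonnegative reals.\<close>
      also have "\<dots> \<le> max 0 b * pb s0 a" using policyD(2)[OF pb s0 a] by (intro mult_right_mono) auto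
      finally have "ennreal (pe s0 a) \<le> ennreal (max 0 b * pb s0 a)" by (rule ennreal_leI)
      then show "ennreal (pe s0 a) \<le> ennreal b * ennreal (pb s0 a)"
        by (simp add: ennreal_mult' max_def ennreal_neg split: if_splits)
    qed
    also have "\<dots> = ennreal b * 1" using policyD(4,5)[OF pb s0] by (subst nn_integral_cmult) auto
    finally have "ennreal 1 \<le> ennreal b" by simp
    then show ?thesis by (simp only: ennreal_le_iff2) auto
  qed
  have bdd: "bdd_below ?Z" using ge1 by (rule bdd_belowI)
  have eq: "real_of_ereal (ratio_bound PS da pe pb) = Inf ?Z"
    unfolding ratio_bound_def using ereal_Inf'[OF bdd ne] by (metis real_of_ereal.simps(1))
  show "real_of_ereal (ratio_bound PS da pe pb) \<ge> 1"
    unfolding eq using ne ge1 by (rule cInf_greatest)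
  fix s a assume s: "s \<in> space PS" and a: "a \<in> space da"
  have nn: "0 \<le> pb s a" by (rule policyD(2)[OF pb s a])
  show "pe s a \<le> real_of_ereal (ratio_bound PS da pe pb) * pb s a"
  proof (cases "pb s a = 0")
    case True
    obtain b where "b \<in> ?Z" using ne by blast
    then have "pe s a \<le> b * pb s a" using s a by blast
    then show ?thesis using True by simp
  next
    case False
    then have pos: "pb s a > 0" using nn by simp
    have "pe s a / pb s a \<le> Inf ?Z"
      using ne
    proof (rule cInf_greatest)
      fix b assume "b \<in> ?Z"
      then have "pe s a \<le> b * pb s a" using s a by blast
      then show "pe s a / pb s a \<le> b" using pos by (simp add: divide_le_eq)
    qed
    then show ?thesis unfolding eq using pos by (simp add: divide_le_eq)
  qed
qed

lemma emeasure_uniform_atMost: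
  assumes "c \<in> {0..1}"
  shows "emeasure (uniform_measure lborel {0..1::real}) {..c} = ennreal c"
proof -
  have "{0..1} \<inter> {..c} = {0..c}" using assms by auto
  then show ?thesis using assms divide_ennreal[of c 1] by (subst emeasure_uniform_measure) auto
qed

section \<open>Rejection sampling\<close>

lemma indep_elements_compose:
  assumes "prob_space M" and ind: "indep_elements M N X K Y"
    and f: "f \<in> N \<rightarrow>\<^sub>M N'" and g: "g \<in> K \<rightarrow>\<^sub>M K'"
  shows "indep_elements M N' (\<lambda>\<omega>. f (X \<omega>)) K' (\<lambda>\<omega>. g (Y \<omega>))"
proof -
  interpret prob_space M by fact
  have X[measurable]: "X \<in> M \<rightarrow>\<^sub>M N" and Y[measurable]: "Y \<in> M \<rightarrow>\<^sub>M K"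
    and I: "indep_set {X -` A \<inter> space M | A. A \<in> sets N} {Y -` A \<inter> space M | A. A \<in> sets K}"
    using ind by (auto simp: indep_elements_def)
  have fX: "(\<lambda>\<omega>. f (X \<omega>)) \<in> M \<rightarrow>\<^sub>M N'" and gY: "(\<lambda>\<omega>. g (Y \<omega>)) \<in> M \<rightarrow>\<^sub>M K'"
    using f g by measurable
  show ?thesis
    unfolding indep_elements_def
  proof (intro conjI fX gY indep_setI)
    show "{(\<lambda>\<omega>. f (X \<omega>)) -` A \<inter> space M |A. A \<in> sets N'} \<subseteq> events"
      "{(\<lambda>\<omega>. g (Y \<omega>)) -` A \<inter> space M |A. A \<in> sets K'} \<subseteq> events"
      using measurable_sets[OF fX] measurable_sets[OF gY] by auto
    fix a b
    assume "a \<in> {(\<lambda>\<omega>. f (X \<omega>)) -` A \<inter> space M |A. A \<in> sets N'}"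
      "b \<in> {(\<lambda>\<omega>. g (Y \<omega>)) -` A \<inter> space M |A. A \<in> sets K'}"
    then obtain A B where AB: "A \<in> sets N'" "B \<in> sets K'"
      "a = (\<lambda>\<omega>. f (X \<omega>)) -` A \<inter> space M" "b = (\<lambda>\<omega>. g (Y \<omega>)) -` B \<inter> space M" by auto
    have "a = X -` (f -` A \<inter> space N) \<inter> space M" "b = Y -` (g -` B \<inter> space K) \<inter> space M"
      using AB measurable_space[OF X] measurable_space[OF Y] by auto
    moreover have "f -` A \<inter> space N \<in> sets N" "g -` B \<inter> space K \<in> sets K"
      using AB f g by (auto intro: measurable_sets)
    ultimately show "prob (a \<inter> b) = prob a * prob b" by (intro indep_setD[OF I]) blast+
  qed
qed

lemma indep_elements_prob:
  assumes "prob_space M" and ind: "indep_elements M N X K Y" and "A \<in> sets N" "B \<in> sets K"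
  shows "measure M {\<omega> \<in> space M. X \<omega> \<in> A \<and> Y \<omega> \<in> B}
    = measure M {\<omega> \<in> space M. X \<omega> \<in> A} * measure M {\<omega> \<in> space M. Y \<omega> \<in> B}"
proof -
  interpret prob_space M by fact
  have I: "indep_set {X -` A \<inter> space M | A. A \<in> sets N} {Y -` A \<inter> space M | A. A \<in> sets K}"
    using ind by (auto simp: indep_elements_def)
  have "prob ((X -` A \<inter> space M) \<inter> (Y -` B \<inter> space M)) = prob (X -` A \<inter> space M) * prob (Y -` B \<inter> space M)"
    using assms(3,4) by (intro indep_setD[OF I]) auto
  moreover have "(X -` A \<inter> space M) \<inter> (Y -` B \<inter> space M) = {\<omega> \<in> space M. X \<omega> \<in> A \<and> Y \<omega> \<in> B}"
    "X -` A \<inter> space M = {\<omega> \<in> space M. X \<omega> \<in> A}" "Y -` B \<inter> space M = {\<omega> \<in> space M. Y \<omega> \<in> B}" by auto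
  ultimately show ?thesis by simp
qed

text \<open>On rectangles, independence of the two vectors splits the probability, independence of
  the coordinates splits each half, and the factors are regrouped by index. Rectangles are an
  intersection-stable generator of the product algebra.\<close>

lemma indep_vars_pair:
  assumes "prob_space M" and I: "finite I" "I \<noteq> {}"
    and X: "prob_space.indep_vars M (\<lambda>_. N) X I" and Y: "prob_space.indep_vars M (\<lambda>_. K) Y I"
    and ind: "indep_elements M (PiM I (\<lambda>_. N)) (\<lambda>\<omega>. \<lambda>i\<in>I. X i \<omega>) (PiM I (\<lambda>_. K)) (\<lambda>\<omega>. \<lambda>i\<in>I. Y i \<omega>)"
  shows "prob_space.indep_vars M (\<lambda>_. N \<Otimes>\<^sub>M K) (\<lambda>i \<omega>. (X i \<omega>, Y i \<omega>)) I"
proof -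
  interpret prob_space M by fact
  have Xm[measurable]: "X i \<in> M \<rightarrow>\<^sub>M N" and Ym[measurable]: "Y i \<in> M \<rightarrow>\<^sub>M K" if "i \<in> I" for i
    using X Y that by (auto simp: indep_vars_def)
  let ?E = "{a \<times> b | a b. a \<in> sets N \<and> b \<in> sets K}"
  have prod: "prob (\<Inter>i\<in>I. (X i -` a i \<inter> space M) \<inter> (Y i -` b i \<inter> space M))
      = (\<Prod>i\<in>I. prob (X i -` a i \<inter> space M)) * (\<Prod>i\<in>I. prob (Y i -` b i \<inter> space M))"
    if ab: "\<And>i. i \<in> I \<Longrightarrow> a i \<in> sets N" "\<And>i. i \<in> I \<Longrightarrow> b i \<in> sets K" for a b
  proof -
    have "(\<Inter>i\<in>I. (X i -` a i \<inter> space M) \<inter> (Y i -` b i \<inter> space M))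
      = {\<omega> \<in> space M. (\<lambda>i\<in>I. X i \<omega>) \<in> PiE I a \<and> (\<lambda>i\<in>I. Y i \<omega>) \<in> PiE I b}"
      using I by (auto simp: restrict_PiE_iff)
    also have "prob \<dots> = prob {\<omega> \<in> space M. (\<lambda>i\<in>I. X i \<omega>) \<in> PiE I a} * prob {\<omega> \<in> space M. (\<lambda>i\<in>I. Y i \<omega>) \<in> PiE I b}"
      using ab I by (intro indep_elements_prob[OF assms(1) ind] sets_PiM_I_finite) auto
    also have "{\<omega> \<in> space M. (\<lambda>i\<in>I. X i \<omega>) \<in> PiE I a} = (\<Inter>i\<in>I. X i -` a i \<inter> space M)"
      using I by (auto simp: restrict_PiE_iff)
    also have "{\<omega> \<in> space M. (\<lambda>i\<in>I. Y i \<omega>) \<in> PiE I b} = (\<Inter>i\<in>I. Y i -` b i \<inter> space M)"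
      using I by (auto simp: restrict_PiE_iff)
    also have "prob (\<Inter>i\<in>I. X i -` a i \<inter> space M) = (\<Prod>i\<in>I. prob (X i -` a i \<inter> space M))"
      using ab I by (intro indep_varsD_finite[OF X]) auto
    also have "prob (\<Inter>i\<in>I. Y i -` b i \<inter> space M) = (\<Prod>i\<in>I. prob (Y i -` b i \<inter> space M))"
      using ab I by (intro indep_varsD_finite[OF Y]) auto
    finally show ?thesis .
  qed
  have single: "prob ((X i -` a \<inter> space M) \<inter> (Y i -` b \<inter> space M)) = prob (X i -` a \<inter> space M) * prob (Y i -` b \<inter> space M)"
    if i: "i \<in> I" and ab: "a \<in> sets N" "b \<in> sets K" for i a b
  proof -
    have "indep_elements M N (\<lambda>\<omega>. (\<lambda>i\<in>I. X i \<omega>) i) K (\<lambda>\<omega>. (\<lambda>i\<in>I. Y i \<omega>) i)"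
      using i by (intro indep_elements_compose[OF assms(1) ind]) measurable
    then have "indep_elements M N (X i) K (Y i)" using i by simp
    from indep_elements_prob[OF assms(1) this ab] show ?thesis
      by (simp add: vimage_def Int_def conj_commute conj_left_commute)
  qed
  show ?thesis
  proof (subst indep_vars_finite[where E = "\<lambda>_. ?E"])
    show "\<forall>A\<in>I \<rightarrow> ?E. prob (\<Inter>j\<in>I. (\<lambda>\<omega>. (X j \<omega>, Y j \<omega>)) -` A j \<inter> space M)
        = (\<Prod>j\<in>I. prob ((\<lambda>\<omega>. (X j \<omega>, Y j \<omega>)) -` A j \<inter> space M))"
    proof
      fix A assume "A \<in> I \<rightarrow> ?E"
      then have "\<forall>i\<in>I. \<exists>a b. A i = a \<times> b \<and> a \<in> sets N \<and> b \<in> sets K" by (auto simp: Pi_iff)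
      then obtain a b where A: "\<And>i. i \<in> I \<Longrightarrow> A i = a i \<times> b i" and ab: "\<And>i. i \<in> I \<Longrightarrow> a i \<in> sets N" "\<And>i. i \<in> I \<Longrightarrow> b i \<in> sets K"
        by metis
      have eq: "(\<lambda>\<omega>. (X i \<omega>, Y i \<omega>)) -` A i \<inter> space M = (X i -` a i \<inter> space M) \<inter> (Y i -` b i \<inter> space M)" if "i \<in> I" for i
        using A[OF that] by auto
      have "prob (\<Inter>j\<in>I. (\<lambda>\<omega>. (X j \<omega>, Y j \<omega>)) -` A j \<inter> space M)
        = (\<Prod>i\<in>I. prob (X i -` a i \<inter> space M)) * (\<Prod>i\<in>I. prob (Y i -` b i \<inter> space M))"
        using prod[OF ab] eq by (simp cong: INF_cong_simp)
      also have "\<dots> = (\<Prod>j\<in>I. prob ((\<lambda>\<omega>. (X j \<omega>, Y j \<omega>)) -` A j \<inter> space M))"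
        unfolding prod.distrib[symmetric] by (intro prod.cong refl) (simp add: eq single ab)
      finally show "prob (\<Inter>j\<in>I. (\<lambda>\<omega>. (X j \<omega>, Y j \<omega>)) -` A j \<inter> space M)
        = (\<Prod>j\<in>I. prob ((\<lambda>\<omega>. (X j \<omega>, Y j \<omega>)) -` A j \<inter> space M))" .
    qed
  qed (use I in \<open>auto simp: sets_pair_measure space_pair_measure intro!: Int_stable_pair_measure_generator dest: sets.sets_into_space\<close>)
qed

text \<open>The increasing enumeration: \<open>sel n A ! j\<close> is the original index of the
  accepted pair at position \<open>j\<close>. The same function lists the training and the
  calibration positions.\<close>

definition sel :: "nat \<Rightarrow> nat set \<Rightarrow> nat list" where
  "sel n A = filter (\<lambda>i. i \<in> A) [0..<n]"

lemma set_sel: "set (sel n A) = A \<inter> {..<n}" by (auto simp: sel_def)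
lemma distinct_sel: "distinct (sel n A)" by (simp add: sel_def)
lemma length_sel: "A \<subseteq> {..<n} \<Longrightarrow> length (sel n A) = card A"
  using distinct_card[OF distinct_sel, of n A] by (simp add: set_sel Int_absorb2)

lemma nths_map_upt: "nths (map x [0..<n]) K = map x (sel n K)"
proof -
  have "zip [0..<n] [0..<n] = map (\<lambda>i. (i, i)) [0..<n]" by (simp add: zip_same_conv_map)
  then have "nths [0..<n] K = sel n K"
    by (simp add: nths_def sel_def filter_map o_def)
  then show ?thesis by (simp add: nths_map)
qed

text \<open>For product sets each index contributes one factor, p times the mass of its set when it
  is in \<open>A\<close> and 1 - p when it is not. Uniqueness of product measures extends this to
  all \<open>X\<close>. The result says that the acceptance pattern and the accepted values
  decouple.\<close>

lemma rejection_law: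
  assumes M: "prob_space M" and n: "n > 0"
    and W: "prob_space.indep_vars M (\<lambda>_. L) W {..<n}"
    and Acc: "Acc \<in> sets L" and h: "h \<in> L \<rightarrow>\<^sub>M Q" and Q: "prob_space Q" and p: "0 \<le> p" "p \<le> 1"
    and law: "\<And>i Y. i < n \<Longrightarrow> Y \<in> sets Q \<Longrightarrow>
      measure M {\<omega> \<in> space M. W i \<omega> \<in> Acc \<and> h (W i \<omega>) \<in> Y} = p * measure Q Y"
    and A: "A \<subseteq> {..<n}" and X: "X \<in> sets (PiM {..<card A} (\<lambda>_. Q))"
  shows "measure M {\<omega> \<in> space M. {i\<in>{..<n}. W i \<omega> \<in> Acc} = A \<and> (\<lambda>j\<in>{..<card A}. h (W (sel n A ! j) \<omega>)) \<in> X}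
    = p ^ card A * (1 - p) ^ (n - card A) * measure (PiM {..<card A} (\<lambda>_. Q)) X"
proof -
  interpret prob_space M by fact
  interpret Q: prob_space Q by fact
  let ?N = "card A"
  let ?P = "PiM {..<?N} (\<lambda>_. Q)"
  interpret PQ: product_sigma_finite "\<lambda>_. Q" by standard
  interpret P: finite_product_prob_space "\<lambda>_. Q" "{..<?N}" by standard simp
  have Wm[measurable]: "W i \<in> M \<rightarrow>\<^sub>M L" if "i < n" for i
    using W that by (auto simp: indep_vars_def)
  note [measurable] = Acc h
  let ?l = "\<lambda>j. sel n A ! j"
  have bij: "bij_betw ?l {..<?N} A"
    using A by (intro bij_betw_nth) (auto simp: distinct_sel length_sel set_sel)
  then have l: "?l j \<in> A" "?l j < n" if "j < ?N" for j
    using that A by (auto simp: bij_betw_def)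
  define x where "x \<omega> = (\<lambda>j\<in>{..<?N}. h (W (?l j) \<omega>))" for \<omega>
  have xm[measurable]: "x \<in> M \<rightarrow>\<^sub>M ?P"
    unfolding x_def using l by (intro measurable_restrict) simp
  define E where "E = {\<omega> \<in> space M. {i\<in>{..<n}. W i \<omega> \<in> Acc} = A}"
  define c where "c = p ^ ?N * (1 - p) ^ (n - ?N)"
  have c: "c \<ge> 0" using p by (simp add: c_def)
  have E[measurable]: "E \<in> events"
  proof -
    have "E = {\<omega> \<in> space M. \<forall>i\<in>{..<n}. (W i \<omega> \<in> Acc) = (i \<in> A)}" using A by (auto simp: E_def)
    also have "\<dots> \<in> events" by measurable
    finally show ?thesis .
  qed
  have rect: "prob (E \<inter> x -` PiE {..<?N} Y \<inter> space M) = c * (\<Prod>j<?N. measure Q (Y j))"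
    if Y: "\<And>j. j < ?N \<Longrightarrow> Y j \<in> sets Q" for Y
  proof -
    let ?idx = "the_inv_into {..<?N} ?l"
    have idx: "?idx i < ?N" "?l (?idx i) = i" if "i \<in> A" for i
    proof -
      have inj: "inj_on ?l {..<?N}" and im: "i \<in> ?l ` {..<?N}"
        using bij that by (auto simp: bij_betw_def)
      show "?l (?idx i) = i" by (rule f_the_inv_into_f[OF inj im])
      show "?idx i < ?N" using the_inv_into_into[OF inj im order_refl] by simp
    qed
    have idx': "?idx (?l j) = j" if "j < ?N" for j
      using bij that by (auto simp: bij_betw_def the_inv_into_f_f)
    \<comment> \<open>The condition on a single index; \<open>?idx\<close> inverts the enumeration,
      giving the position at which index \<open>i\<close> appears among the accepted ones.\<close>
    let ?Z = "\<lambda>i. if i \<in> A then {w \<in> space L. w \<in> Acc \<and> h w \<in> Y (?idx i)} else space L - Acc"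
    have Zm: "?Z i \<in> sets L" for i
    proof (cases "i \<in> A")
      case True
      then have [measurable]: "Y (?idx i) \<in> sets Q" using Y idx by auto
      show ?thesis using True by simp
    qed (simp)
    have "E \<inter> x -` PiE {..<?N} Y \<inter> space M = (\<Inter>i\<in>{..<n}. W i -` ?Z i \<inter> space M)"
    proof (intro set_eqI iffI)
      fix \<omega> assume w: "\<omega> \<in> E \<inter> x -` PiE {..<?N} Y \<inter> space M"
      then have a: "{i\<in>{..<n}. W i \<omega> \<in> Acc} = A" and y: "\<And>j. j < ?N \<Longrightarrow> h (W (?l j) \<omega>) \<in> Y j"
        by (auto simp: E_def x_def restrict_PiE_iff)
      show "\<omega> \<in> (\<Inter>i\<in>{..<n}. W i -` ?Z i \<inter> space M)"
      proof
        fix i assume i: "i \<in> {..<n}"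
        have sp: "\<omega> \<in> space M" using w by simp
        have L: "W i \<omega> \<in> space L" using sp i measurable_space[OF Wm] by simp
        have iA: "W i \<omega> \<in> Acc \<longleftrightarrow> i \<in> A" using a i by blast
        have "W i \<omega> \<in> ?Z i"
        proof (cases "i \<in> A")
          case True
          have "h (W i \<omega>) \<in> Y (?idx i)" using y[OF idx(1)[OF True]] unfolding idx(2)[OF True] .
          then show ?thesis using True L iA by simp
        next
          case False
          then show ?thesis using L iA by simp
        qed
        then show "\<omega> \<in> W i -` ?Z i \<inter> space M" using sp by simp
      qed
    next
      fix \<omega> assume w: "\<omega> \<in> (\<Inter>i\<in>{..<n}. W i -` ?Z i \<inter> space M)"
      have wi: "\<omega> \<in> W i -` ?Z i \<inter> space M" if "i < n" for i
        using w by (rule INT_D) (simp add: that)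
      have sp: "\<omega> \<in> space M" by (rule IntD2[OF wi[OF n]])
      have z: "W i \<omega> \<in> ?Z i" if "i < n" for i by (rule vimageD[OF IntD1[OF wi[OF that]]])
      have "W i \<omega> \<in> Acc \<longleftrightarrow> i \<in> A" if "i < n" for i
        using z[OF that] by (cases "i \<in> A") simp_all
      then have "{i\<in>{..<n}. W i \<omega> \<in> Acc} = A" using A by blast
      moreover have "h (W (?l j) \<omega>) \<in> Y j" if "j < ?N" for j
        using z[OF l(2)[OF that]] l(1)[OF that] by (simp add: idx'[OF that])
      ultimately show "\<omega> \<in> E \<inter> x -` PiE {..<?N} Y \<inter> space M"
        using sp by (auto simp: E_def x_def restrict_PiE_iff)
    qed
    also have "prob \<dots> = (\<Prod>i<n. prob (W i -` ?Z i \<inter> space M))"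
      using n Zm by (intro indep_varsD_finite[OF W]) auto
    also have "\<dots> = (\<Prod>i<n. if i \<in> A then p * measure Q (Y (?idx i)) else 1 - p)"
    proof (intro prod.cong refl)
      fix i assume "i \<in> {..<n}"
      then have i: "i < n" by simp
      show "prob (W i -` ?Z i \<inter> space M) = (if i \<in> A then p * measure Q (Y (?idx i)) else 1 - p)"
      proof (cases "i \<in> A")
        case True
        have "W i -` ?Z i \<inter> space M = {\<omega> \<in> space M. W i \<omega> \<in> Acc \<and> h (W i \<omega>) \<in> Y (?idx i)}"
          using True measurable_space[OF Wm[OF i]] by auto
        then show ?thesis using True law[OF i Y[OF idx(1)[OF True]]] by simp
      next
        case False
        have "prob (W i -` ?Z i \<inter> space M) = prob (space M - {\<omega> \<in> space M. W i \<omega> \<in> Acc})"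
          using False measurable_space[OF Wm[OF i]] by (intro arg_cong[of _ _ prob]) auto
        also have "\<dots> = 1 - prob {\<omega> \<in> space M. W i \<omega> \<in> Acc}"
          using i by (intro prob_compl) measurable
        \<comment> \<open>Putting the whole space for the value set in \<open>law\<close> yields the
          acceptance probability alone.\<close>
        also have "{\<omega> \<in> space M. W i \<omega> \<in> Acc} = {\<omega> \<in> space M. W i \<omega> \<in> Acc \<and> h (W i \<omega>) \<in> space Q}"
          using measurable_space[OF Wm[OF i]] measurable_space[OF h] by auto
        also have "prob \<dots> = p" using law[OF i sets.top] by (simp add: Q.prob_space)
        finally show ?thesis using False by simp
      qed
    qed
    also have "\<dots> = (\<Prod>i\<in>A. p * measure Q (Y (?idx i))) * (\<Prod>i\<in>{..<n} - A. 1 - p)"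
      using A by (simp add: prod.If_cases Int_absorb1 Diff_eq)
    also have "(\<Prod>i\<in>{..<n} - A. 1 - p) = (1 - p) ^ (n - ?N)"
      using A by (simp add: card_Diff_subset finite_subset)
    also have "(\<Prod>i\<in>A. p * measure Q (Y (?idx i))) = p ^ ?N * (\<Prod>j<?N. measure Q (Y j))"
    proof -
      have "(\<Prod>i\<in>A. measure Q (Y (?idx i))) = (\<Prod>j<?N. measure Q (Y (?idx (?l j))))"
        by (rule prod.reindex_bij_betw[OF bij, symmetric])
      also have "\<dots> = (\<Prod>j<?N. measure Q (Y j))" using idx' by (intro prod.cong) auto
      finally show ?thesis by (simp add: prod.distrib)
    qed
    finally show ?thesis by (simp add: c_def mult_ac)
  qed
  have eqE: "{\<omega> \<in> space M. {i\<in>{..<n}. W i \<omega> \<in> Acc} = A \<and> (\<lambda>j\<in>{..<?N}. h (W (?l j) \<omega>)) \<in> X} = E \<inter> x -` X \<inter> space M"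
    by (auto simp: E_def x_def)
  \<comment> \<open>Dividing by \<open>c\<close> makes the law of the values on \<open>E\<close>
    agree with the product measure on product sets, hence everywhere. For c = 0, for instance when p
    = 1 and some index is rejected, no division is possible, but then \<open>E\<close> is
    null.\<close>
  have "prob (E \<inter> x -` X \<inter> space M) = c * measure ?P X"
  proof (cases "c = 0")
    case True
    have "x -` PiE {..<?N} (\<lambda>_. space Q) \<inter> space M = space M"
      using measurable_space[OF xm] by (auto simp: space_PiM)
    then have "prob E = 0" using rect[of "\<lambda>_. space Q"] True sets.sets_into_space[OF E]
      by (simp add: Int_assoc Int_absorb2)
    moreover have "prob (E \<inter> x -` X \<inter> space M) \<le> prob E" by (intro finite_measure_mono) auto
    ultimately show ?thesis using True by (simp add: measure_le_0_iff)
  next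
    case False
    then have c0: "c > 0" using c by simp
    let ?R = "distr (density M (\<lambda>\<omega>. ennreal (1 / c) * indicator E \<omega>)) ?P x"
    have R: "emeasure ?R Z = ennreal (1 / c) * emeasure M (E \<inter> x -` Z \<inter> space M)" if Z[measurable]: "Z \<in> sets ?P" for Z
    proof -
      have "emeasure ?R Z = (\<integral>\<^sup>+\<omega>. ennreal (1 / c) * indicator E \<omega> * indicator (x -` Z \<inter> space M) \<omega> \<partial>M)"
        by (subst emeasure_distr) (auto simp: emeasure_density)
      also have "\<dots> = (\<integral>\<^sup>+\<omega>. ennreal (1 / c) * indicator (E \<inter> x -` Z \<inter> space M) \<omega> \<partial>M)"
        by (intro nn_integral_cong) (auto simp: indicator_def)
      also have "\<dots> = ennreal (1 / c) * emeasure M (E \<inter> x -` Z \<inter> space M)"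
        by (subst nn_integral_cmult_indicator) auto
      finally show ?thesis .
    qed
    have "?R = ?P"
    proof (rule PQ.PiM_eqI)
      fix Y assume "\<And>j. j \<in> {..<?N} \<Longrightarrow> Y j \<in> sets Q"
      then have Y: "\<And>j. j < ?N \<Longrightarrow> Y j \<in> sets Q" by simp
      then have "emeasure ?R (PiE {..<?N} Y) = ennreal (1 / c) * ennreal (c * (\<Prod>j<?N. measure Q (Y j)))"
        by (subst R) (auto simp: emeasure_eq_measure rect intro!: sets_PiM_I_finite)
      also have "\<dots> = ennreal (\<Prod>j<?N. measure Q (Y j))"
        using c0 by (subst ennreal_mult[symmetric]) (auto intro!: mult_nonneg_nonneg prod_nonneg)
      also have "\<dots> = (\<Prod>j<?N. emeasure Q (Y j))"
        by (simp add: Q.emeasure_eq_measure prod_ennreal)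
      finally show "emeasure ?R (PiE {..<?N} Y) = (\<Prod>j<?N. emeasure Q (Y j))" .
    qed auto
    then have "emeasure ?P X = ennreal (1 / c) * emeasure M (E \<inter> x -` X \<inter> space M)" using R[OF X] by simp
    then have "ennreal (measure ?P X) = ennreal (1 / c) * ennreal (prob (E \<inter> x -` X \<inter> space M))"
      by (simp only: P.emeasure_eq_measure emeasure_eq_measure)
    also have "\<dots> = ennreal (1 / c * prob (E \<inter> x -` X \<inter> space M))"
      using c0 by (intro ennreal_mult[symmetric]) auto
    finally have "measure ?P X = 1 / c * prob (E \<inter> x -` X \<inter> space M)"
      using c0 by (subst (asm) ennreal_inj) auto
    then show ?thesis using c0 by simp
  qed
  then show ?thesis unfolding eqE c_def .
qed

section \<open>The known-behavior-policy procedure\<close>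

definition accepted ::
  "('s \<Rightarrow> 'a \<Rightarrow> real) \<Rightarrow> real \<Rightarrow> nat \<Rightarrow> (nat \<Rightarrow> 's \<times> 'a \<times> real) \<Rightarrow> (nat \<Rightarrow> real) \<Rightarrow> nat set" where
  "accepted w B n d v = {i\<in>{..<n}. v i \<le> w (fst (d i)) (fst (snd (d i))) / B}"

text \<open>Restricted to the positions below \<open>card A\<close>, so that the value is a genuine
  point of the product space on which the law of the accepted sample lives.\<close>

definition pick :: "nat \<Rightarrow> nat set \<Rightarrow> (nat \<Rightarrow> 's \<times> 'a \<times> real) \<Rightarrow> nat \<Rightarrow> 's \<times> real" where
  "pick n A d = (\<lambda>j\<in>{..<card A}. (fst (d (sel n A ! j)), snd (snd (d (sel n A ! j)))))"

text \<open>Here \<open>K\<close> is a fixed position set in place of the random split, and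
  \<open>x\<close> is the whole accepted sample, of which training reads only the positions outside
  \<open>K\<close>.\<close>

definition cal_score ::
  "(('s \<times> real) list \<Rightarrow> 's \<Rightarrow> real) \<Rightarrow> (('s \<times> real) list \<Rightarrow> 's \<Rightarrow> real) \<Rightarrow> nat \<Rightarrow> nat set
    \<Rightarrow> (nat \<Rightarrow> 's \<times> real) \<Rightarrow> 's \<times> real \<Rightarrow> real" where
  "cal_score q1 q2 N K x = score (q1 (map x (sel N (- K)))) (q2 (map x (sel N (- K))))"

definition cal_threshold ::
  "real \<Rightarrow> real \<Rightarrow> (('s \<times> real) list \<Rightarrow> 's \<Rightarrow> real) \<Rightarrow> (('s \<times> real) list \<Rightarrow> 's \<Rightarrow> real) \<Rightarrow> nat \<Rightarrow> nat set
    \<Rightarrow> (nat \<Rightarrow> 's \<times> real) \<Rightarrow> ereal" where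
  "cal_threshold \<epsilon> \<delta> q1 q2 N K x = threshold \<epsilon> \<delta> (map (\<lambda>i. cal_score q1 q2 N K x (x i)) (sel N K))"

lemma accepted_subset: "accepted w B n d v \<subseteq> {..<n}" by (auto simp: accepted_def)

text \<open>Gives the accepted list the form \<open>map x [0..<N]\<close> with \<open>x\<close> in a
  product space, the form in which laws and measurability are available.\<close>

lemma rejection_sample_eq:
  "rejection_sample w B n d v
    = map (pick n (accepted w B n d v) d) [0..<card (accepted w B n d v)]"
proof -
  let ?A = "accepted w B n d v"
  have "rejection_sample w B n d v = map (\<lambda>i. (fst (d i), snd (snd (d i)))) (sel n ?A)"
    unfolding rejection_sample_def sel_def accepted_def split_beta'
    by (intro arg_cong2[where f = map] filter_cong) auto
  also have "\<dots> = map (\<lambda>j. (fst (d (sel n ?A ! j)), snd (snd (d (sel n ?A ! j))))) [0..<card ?A]"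
    using length_sel[OF accepted_subset[of w B n d v]] by (intro nth_equalityI) auto
  also have "\<dots> = map (pick n ?A d) [0..<card ?A]" by (simp add: pick_def)
  finally show ?thesis .
qed

lemma calibration_scores_eq:
  "calibration_scores q lo up J (map x [0..<N])
    = map (\<lambda>i. cal_score (q lo) (q up) N (J N) x (x i)) (sel N (J N))"
  by (simp add: calibration_scores_def training_set_def calibration_set_def nths_map_upt cal_score_def)

lemma not_in_band_iff: "t \<noteq> -\<infinity> \<Longrightarrow> r \<notin> band ql qu t s \<longleftrightarrow> t < ereal (score ql qu (s, r))"
  by (cases t) (auto simp: band_def score_def max_def)

lemma threshold_not_MInfty: "threshold \<epsilon> \<delta> ts \<noteq> -\<infinity>"
  by (simp add: threshold_def order_stat_def)

lemma not_in_prediction_interval_iff: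
  "r \<notin> prediction_interval q lo up \<epsilon> \<delta> J (map x [0..<N]) s
    \<longleftrightarrow> cal_threshold \<epsilon> \<delta> (q lo) (q up) N (J N) x < ereal (cal_score (q lo) (q up) N (J N) x (s, r))"
  unfolding prediction_interval_def not_in_band_iff[OF threshold_not_MInfty] calibration_scores_eq cal_threshold_def
  by (simp add: cal_score_def training_set_def nths_map_upt)

text \<open>Measurability of training is assumed for lists indexed by an initial segment only;
  renumbering the positions \<open>ks\<close> carries it over to any selection of
  coordinates.\<close>

lemma measurable_training_map:
  assumes q: "measurable_training PS q" and ks: "set ks \<subseteq> I"
  shows "(\<lambda>(x, s). q (map x ks) s) \<in> borel_measurable (PiM I (\<lambda>_. PS \<Otimes>\<^sub>M borel) \<Otimes>\<^sub>M PS)"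
proof -
  let ?m = "length ks"
  let ?r = "\<lambda>x. \<lambda>j\<in>{..<?m}. x (ks ! j)"
  have r: "?r \<in> PiM I (\<lambda>_. PS \<Otimes>\<^sub>M borel) \<rightarrow>\<^sub>M PiM {..<?m} (\<lambda>_. PS \<Otimes>\<^sub>M (borel :: real measure))"
    using ks by (intro measurable_restrict measurable_component_singleton) (auto intro!: subsetD[OF ks])
  have m: "(\<lambda>z. (?r (fst z), snd z)) \<in> PiM I (\<lambda>_. PS \<Otimes>\<^sub>M borel) \<Otimes>\<^sub>M PS
      \<rightarrow>\<^sub>M PiM {..<?m} (\<lambda>_. PS \<Otimes>\<^sub>M (borel :: real measure)) \<Otimes>\<^sub>M PS"
    using r by measurable
  have eq: "map (?r x) [0..<?m] = map x ks" for x by (rule nth_equalityI) auto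
  from q have "(\<lambda>(x, s). q (map x [0..<?m]) s) \<in> borel_measurable (PiM {..<?m} (\<lambda>_. PS \<Otimes>\<^sub>M borel) \<Otimes>\<^sub>M PS)"
    by (simp add: measurable_training_def)
  from measurable_compose[OF m this] show ?thesis by (simp add: split_beta' eq)
qed

lemma measurable_cal_score:
  assumes q: "measurable_training PS q1" "measurable_training PS q2" and I: "{..<N} - K \<subseteq> I"
  shows "(\<lambda>(x, y). cal_score q1 q2 N K x y) \<in> borel_measurable (PiM I (\<lambda>_. PS \<Otimes>\<^sub>M borel) \<Otimes>\<^sub>M (PS \<Otimes>\<^sub>M borel))"
proof -
  let ?ks = "sel N (- K)"
  have ks: "set ?ks \<subseteq> I" using I by (auto simp: set_sel)
  have m: "(\<lambda>z. (fst z, fst (snd z))) \<in> PiM I (\<lambda>_. PS \<Otimes>\<^sub>M borel) \<Otimes>\<^sub>M (PS \<Otimes>\<^sub>M (borel :: real measure))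
    \<rightarrow>\<^sub>M PiM I (\<lambda>_. PS \<Otimes>\<^sub>M (borel :: real measure)) \<Otimes>\<^sub>M PS" by measurable
  have "(\<lambda>z. max (q1 (map (fst z) ?ks) (fst (snd z)) - snd (snd z)) (snd (snd z) - q2 (map (fst z) ?ks) (fst (snd z))))
    \<in> borel_measurable (PiM I (\<lambda>_. PS \<Otimes>\<^sub>M borel) \<Otimes>\<^sub>M (PS \<Otimes>\<^sub>M borel))"
    using measurable_compose[OF m measurable_training_map[OF q(1) ks]]
      measurable_compose[OF m measurable_training_map[OF q(2) ks]]
    by (intro borel_measurable_max borel_measurable_diff) (simp_all add: split_beta')
  then show ?thesis by (simp add: cal_score_def score_def split_beta')
qed

lemma measurable_cal_score_component:
  assumes q: "measurable_training PS q1" "measurable_training PS q2" and i: "i < N"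
  shows "(\<lambda>x. cal_score q1 q2 N K x (x i)) \<in> borel_measurable (PiM {..<N} (\<lambda>_. PS \<Otimes>\<^sub>M borel))"
proof -
  have "(\<lambda>x. (x, x i)) \<in> PiM {..<N} (\<lambda>_. PS \<Otimes>\<^sub>M (borel :: real measure))
    \<rightarrow>\<^sub>M PiM {..<N} (\<lambda>_. PS \<Otimes>\<^sub>M borel) \<Otimes>\<^sub>M (PS \<Otimes>\<^sub>M borel)"
    using i by (intro measurable_Pair measurable_component_singleton) auto
  from measurable_compose[OF this measurable_cal_score[OF q, of N K "{..<N}"]] show ?thesis by simp
qed

lemma measurable_cal_threshold:
  assumes q: "measurable_training PS q1" "measurable_training PS q2"
  shows "cal_threshold \<epsilon> \<delta> q1 q2 N K \<in> borel_measurable (PiM {..<N} (\<lambda>_. PS \<Otimes>\<^sub>M borel))"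
  unfolding cal_threshold_def
  by (intro measurable_threshold measurable_cal_score_component q) (simp add: set_sel)

lemma cal_score_restrict:
  "cal_score q1 q2 N K (restrict x ({..<N} - K)) = cal_score q1 q2 N K x"
proof -
  have eq: "map (restrict x ({..<N} - K)) (sel N (- K)) = map x (sel N (- K))"
    by (auto simp: set_sel)
  show ?thesis unfolding cal_score_def eq ..
qed

lemma prob_low_miscoverage_le:
  assumes Q: "prob_space Q" and setsQ: "sets Q = sets (PS \<Otimes>\<^sub>M borel)"
    and \<epsilon>: "\<epsilon> \<in> {0<..<1}" and \<delta>: "\<delta> \<in> {0<..<1}" and \<gamma>: "\<gamma> \<in> {0<..<1}"
    and q: "measurable_training PS q1" "measurable_training PS q2"
    and K: "K \<subseteq> {..<N}" "card K = nat \<lceil>\<gamma> * real N\<rceil>"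
    and dist: "AE x in PiM {..<N} (\<lambda>_. Q). distinct (map (\<lambda>i. cal_score q1 q2 N K x (x i)) (sel N K))"
  shows "measure (PiM {..<N} (\<lambda>_. Q)) {x \<in> space (PiM {..<N} (\<lambda>_. Q)).
      excess_prob Q (cal_score q1 q2 N K x) (cal_threshold \<epsilon> \<delta> q1 q2 N K x) \<le> \<epsilon>}
    \<le> 1 - \<delta> + 1 / sqrt (\<gamma> * \<epsilon> * (1 - \<epsilon>)) / sqrt (real N + 1)" (is "measure ?P ?E \<le> _")
proof -
  interpret prob_space Q by fact
  interpret P: finite_product_prob_space "\<lambda>_. Q" "{..<N}" by standard simp
  have ee: "0 < \<epsilon> * (1 - \<epsilon>)" "\<epsilon> * (1 - \<epsilon>) \<le> 1/4"
    using \<epsilon> zero_le_power2[of "\<epsilon> - 1/2"] by (simp_all add: power2_eq_square algebra_simps)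
  have pos: "0 < \<gamma> * \<epsilon> * (1 - \<epsilon>)" using ee(1) \<gamma> by (simp add: mult.assoc)
  show ?thesis
  proof (cases "N = 0")
    case True
    \<comment> \<open>With no accepted pair there is nothing to calibrate, and the error term is
      already at least 1.\<close>
    have "\<gamma> * (\<epsilon> * (1 - \<epsilon>)) \<le> 1 * 1" using \<gamma> ee by (intro mult_mono) auto
    then have "sqrt (\<gamma> * \<epsilon> * (1 - \<epsilon>)) \<le> 1" by (simp add: mult.assoc)
    then have "1 \<le> 1 / sqrt (\<gamma> * \<epsilon> * (1 - \<epsilon>))" using pos by simp
    moreover have "measure ?P ?E \<le> 1" by (rule P.prob_le_1)
    ultimately show ?thesis using \<delta> unfolding True by (simp only: of_nat_0 add_0 real_sqrt_one div_by_1) auto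
  next
    case False
    let ?T = "{..<N} - K"
    let ?ks = "sel N K"
    have set_ks: "set ?ks = K" using K by (auto simp: set_sel)
    have TK: "?T \<union> set ?ks = {..<N}" using K set_ks by auto
    have len: "length ?ks = card K" using K(1) by (rule length_sel)
    have "\<gamma> * real N > 0" using \<gamma> False by simp
    then have "card K > 0" using K(2) by simp
    then have ne: "?ks \<noteq> []" using len by auto
    have sP: "sets (PiM ?T (\<lambda>_. Q)) = sets (PiM ?T (\<lambda>_. PS \<Otimes>\<^sub>M borel))" by (intro sets_PiM_cong setsQ) auto
    have F: "(\<lambda>(x, y). cal_score q1 q2 N K x y) \<in> borel_measurable (PiM ?T (\<lambda>_. Q) \<Otimes>\<^sub>M Q)"
      using measurable_cal_score[OF q, of N K ?T] sets_pair_measure_cong[OF sP setsQ]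
      by (simp cong: measurable_cong_sets)
    have "measure (PiM (?T \<union> set ?ks) (\<lambda>_. Q)) {x \<in> space (PiM (?T \<union> set ?ks) (\<lambda>_. Q)).
      excess_prob Q (cal_score q1 q2 N K (restrict x ?T)) (threshold \<epsilon> \<delta> (map (\<lambda>i. cal_score q1 q2 N K (restrict x ?T) (x i)) ?ks)) \<le> \<epsilon>}
      \<le> 1 - \<delta> + 1 / sqrt (2 * real (length ?ks) * \<epsilon> * (1 - \<epsilon>))"
    proof (rule split_conformal_coverage_upper_bound[OF Q \<epsilon> \<delta> distinct_sel ne _ _ F])
      show "AE x in PiM (?T \<union> set ?ks) (\<lambda>_. Q). distinct (map (\<lambda>i. cal_score q1 q2 N K (restrict x ?T) (x i)) ?ks)"
        unfolding TK cal_score_restrict by (rule dist)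
    qed (use set_ks in auto)
    then have "measure ?P ?E \<le> 1 - \<delta> + 1 / sqrt (2 * real (card K) * \<epsilon> * (1 - \<epsilon>))"
      by (simp only: TK cal_score_restrict len cal_threshold_def[symmetric])
    also have "\<dots> \<le> 1 - \<delta> + 1 / sqrt (\<gamma> * \<epsilon> * (1 - \<epsilon>) * (real N + 1))"
    proof -
      \<comment> \<open>The factor 2 in the point mass bound pays for the passage from N to N + 1:
        the calibration size is at least \<gamma> N, and \<gamma> N \<ge> \<gamma> because N \<ge>
        1.\<close>
      have "\<gamma> * real N \<le> real (card K)" using K(2) by linarith
      moreover have "\<gamma> * 1 \<le> \<gamma> * real N" using \<gamma> False by (intro mult_left_mono) auto
      ultimately have "\<gamma> * (real N + 1) \<le> 2 * real (card K)" by (simp add: algebra_simps)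
      then have "\<gamma> * (real N + 1) * (\<epsilon> * (1 - \<epsilon>)) \<le> 2 * real (card K) * (\<epsilon> * (1 - \<epsilon>))"
        using ee by (intro mult_right_mono) auto
      then have "\<gamma> * \<epsilon> * (1 - \<epsilon>) * (real N + 1) \<le> 2 * real (card K) * \<epsilon> * (1 - \<epsilon>)"
        by (simp only: mult_ac)
      then have "sqrt (\<gamma> * \<epsilon> * (1 - \<epsilon>) * (real N + 1)) \<le> sqrt (2 * real (card K) * \<epsilon> * (1 - \<epsilon>))"
        by simp
      moreover have "0 < sqrt (\<gamma> * \<epsilon> * (1 - \<epsilon>) * (real N + 1))" using pos by simp
      ultimately show ?thesis by (intro add_left_mono frac_le) auto
    qed
    finally show ?thesis by (simp add: real_sqrt_mult)
  qed
qed

section \<open>Acceptance of a single data point\<close>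

definition accept_region ::
  "'s measure \<Rightarrow> 'a measure \<Rightarrow> ('s \<Rightarrow> 'a \<Rightarrow> real) \<Rightarrow> real \<Rightarrow> (('s \<times> 'a \<times> real) \<times> real) set" where
  "accept_region PS da w B = {z \<in> space ((PS \<Otimes>\<^sub>M da \<Otimes>\<^sub>M borel) \<Otimes>\<^sub>M borel).
    snd z \<le> w (fst (fst z)) (fst (snd (fst z))) / B}"

text \<open>Given the data point, the uniform variable accepts with probability weight / B;
  integrating and changing the measure leaves the target law times 1 / B. So acceptance has
  probability 1 / B and an accepted pair follows the target law.\<close>

lemma acceptance_law:
  assumes M: "prob_space M" and PS: "prob_space PS" and PR: "PR \<in> PS \<Otimes>\<^sub>M da \<rightarrow>\<^sub>M prob_algebra (borel :: real measure)"
    and pb: "policy PS da pb" and pe: "policy PS da pe"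
    and B: "B > 0" "\<And>s a. s \<in> space PS \<Longrightarrow> a \<in> space da \<Longrightarrow> pe s a \<le> B * pb s a"
    and ind: "indep_elements M (PS \<Otimes>\<^sub>M da \<Otimes>\<^sub>M borel) X borel V"
    and X: "distr M (PS \<Otimes>\<^sub>M da \<Otimes>\<^sub>M borel) X = data_law PS da PR pb"
    and V: "distr M borel V = uniform_measure lborel {0..1}"
    and Y: "Y \<in> sets (PS \<Otimes>\<^sub>M borel)"
  shows "accept_region PS da (weight pe pb) B \<in> sets ((PS \<Otimes>\<^sub>M da \<Otimes>\<^sub>M borel) \<Otimes>\<^sub>M borel)"
    and "measure M {\<omega> \<in> space M. (X \<omega>, V \<omega>) \<in> accept_region PS da (weight pe pb) B \<and> (fst (X \<omega>), snd (snd (X \<omega>))) \<in> Y}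
    = 1 / B * measure (target_law PS da PR pe) Y"
proof -
  interpret prob_space M by fact
  let ?L = "PS \<Otimes>\<^sub>M da \<Otimes>\<^sub>M (borel :: real measure)"
  let ?Acc = "accept_region PS da (weight pe pb) B"
  let ?U = "uniform_measure lborel {0..1::real}"
  let ?Q = "target_law PS da PR pe"
  interpret U: prob_space ?U by (rule prob_space_uniform_measure) auto
  interpret E: prob_space "data_law PS da PR pe" by (rule prob_space_data_law[OF PS PR pe])
  have Xm[measurable]: "X \<in> M \<rightarrow>\<^sub>M ?L" and Vm[measurable]: "V \<in> borel_measurable M"
    using ind by (auto simp: indep_elements_def)
  note [measurable] = Y
  have pm: "(\<lambda>z. (fst (fst z), fst (snd (fst z)))) \<in> ?L \<Otimes>\<^sub>M (borel :: real measure) \<rightarrow>\<^sub>M PS \<Otimes>\<^sub>M da" by measurable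
  have [measurable]: "(\<lambda>z. weight pe pb (fst (fst z)) (fst (snd (fst z)))) \<in> borel_measurable (?L \<Otimes>\<^sub>M (borel :: real measure))"
    unfolding weight_def
    using measurable_compose[OF pm policyD(1)[OF pb]] measurable_compose[OF pm policyD(1)[OF pe]]
    by (intro borel_measurable_divide) simp_all
  show Acc[measurable]: "?Acc \<in> sets (?L \<Otimes>\<^sub>M borel)" unfolding accept_region_def by measurable
  let ?S = "{z \<in> space (?L \<Otimes>\<^sub>M (borel :: real measure)). z \<in> ?Acc \<and> (fst (fst z), snd (snd (fst z))) \<in> Y}"
  let ?H = "\<lambda>z. indicator Y (fst z, snd (snd z)) :: ennreal"
  have S: "?S \<in> sets (?L \<Otimes>\<^sub>M borel)" by measurable
  have H: "?H \<in> borel_measurable ?L" by measurable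
  have XV: "(X \<omega>, V \<omega>) \<in> space (?L \<Otimes>\<^sub>M (borel :: real measure))" if "\<omega> \<in> space M" for \<omega>
    using measurable_space[OF Xm that] by (simp add: space_pair_measure)
  have "emeasure M {\<omega> \<in> space M. (X \<omega>, V \<omega>) \<in> ?Acc \<and> (fst (X \<omega>), snd (snd (X \<omega>))) \<in> Y}
    = emeasure (distr M (?L \<Otimes>\<^sub>M borel) (\<lambda>\<omega>. (X \<omega>, V \<omega>))) ?S"
    using S XV by (subst emeasure_distr) (auto intro!: arg_cong[of _ _ "emeasure M"])
  also have "\<dots> = emeasure (data_law PS da PR pb \<Otimes>\<^sub>M ?U) ?S"
    by (simp add: indep_elements_joint_law[OF M ind] X V)
  also have "\<dots> = (\<integral>\<^sup>+z. emeasure ?U (Pair z -` ?S) \<partial>data_law PS da PR pb)"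
    using S sets_pair_measure_cong[OF sets_data_law[OF PS PR pb], of ?U borel]
    by (intro U.emeasure_pair_measure_alt) simp
  also have "\<dots> = (\<integral>\<^sup>+(s, a, r). ennreal (weight pe pb s a / B) * ?H (s, a, r) \<partial>data_law PS da PR pb)"
  proof (rule nn_integral_cong, unfold split_beta')
    fix z assume "z \<in> space (data_law PS da PR pb)"
    then have z: "z \<in> space ?L" using sets_eq_imp_space_eq[OF sets_data_law[OF PS PR pb]] by simp
    let ?c = "weight pe pb (fst z) (fst (snd z)) / B"
    have sa: "fst z \<in> space PS" "fst (snd z) \<in> space da" using z by (auto simp: space_pair_measure)
    have nn: "0 \<le> pb (fst z) (fst (snd z))" "0 \<le> pe (fst z) (fst (snd z))"
      using policyD(2)[OF pb sa] policyD(2)[OF pe sa] by auto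
    \<comment> \<open>The uniform mass of a lower half-line equals its endpoint only for endpoints
      in [0, 1]; the upper limit is where the density bound by B enters.\<close>
    have c: "?c \<in> {0..1}"
    proof (cases "pb (fst z) (fst (snd z)) = 0")
      case False
      then have "pb (fst z) (fst (snd z)) > 0" using nn by simp
      then show ?thesis using B(2)[OF sa] nn B(1) by (simp add: weight_def divide_le_eq mult.commute)
    qed (simp add: weight_def)
    have "Pair z -` ?S = (if (fst z, snd (snd z)) \<in> Y then {..?c} else {})"
      using z by (auto simp: space_pair_measure accept_region_def)
    then show "emeasure ?U (Pair z -` ?S) = ennreal (weight pe pb (fst z) (fst (snd z)) / B) * ?H (fst z, fst (snd z), snd (snd z))"
      using emeasure_uniform_atMost[OF c] by (simp add: indicator_def)
  qed
  also have "\<dots> = ennreal (1 / B) * (\<integral>\<^sup>+z. ?H z \<partial>data_law PS da PR pe)"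
    by (rule nn_integral_data_law_weight[OF PS PR pb pe B H])
  also have "(\<integral>\<^sup>+z. ?H z \<partial>data_law PS da PR pe) = emeasure ?Q Y"
  proof -
    have m: "(\<lambda>(s, a, r). (s, r)) \<in> data_law PS da PR pe \<rightarrow>\<^sub>M PS \<Otimes>\<^sub>M borel"
      using sets_data_law[OF PS PR pe] by (simp add: split_beta' cong: measurable_cong_sets)
    have "(\<integral>\<^sup>+z. ?H z \<partial>data_law PS da PR pe) = (\<integral>\<^sup>+z. indicator Y z \<partial>?Q)"
      unfolding target_law_def using m by (subst nn_integral_distr) (auto simp: split_beta')
    also have "\<dots> = emeasure ?Q Y" by (rule nn_integral_indicator) (simp add: target_law_def)
    finally show ?thesis .
  qed
  finally have eq: "emeasure M {\<omega> \<in> space M. (X \<omega>, V \<omega>) \<in> ?Acc \<and> (fst (X \<omega>), snd (snd (X \<omega>))) \<in> Y}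
    = ennreal (1 / B) * emeasure ?Q Y" .
  show "measure M {\<omega> \<in> space M. (X \<omega>, V \<omega>) \<in> ?Acc \<and> (fst (X \<omega>), snd (snd (X \<omega>))) \<in> Y} = 1 / B * measure ?Q Y"
    unfolding measure_def eq using B(1) by (simp add: enn2real_mult)
qed

theorem theorem2:
  fixes PS :: "'s measure" and da :: "'a measure"
    and PR :: "'s \<times> 'a \<Rightarrow> real measure"
    and pb pe :: "'s \<Rightarrow> 'a \<Rightarrow> real"
    and q :: "real \<Rightarrow> ('s \<times> real) list \<Rightarrow> 's \<Rightarrow> real"
    and M :: "'w measure"
    and D :: "nat \<Rightarrow> 'w \<Rightarrow> 's \<times> 'a \<times> real"
    and V :: "nat \<Rightarrow> 'w \<Rightarrow> real"
    and J :: "'w \<Rightarrow> nat \<Rightarrow> nat set"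
    and S' :: "'w \<Rightarrow> 's" and R' :: "'w \<Rightarrow> real"
    and \<epsilon> \<delta> \<gamma> \<epsilon>lo \<epsilon>up B m0 C :: real and n :: nat
  defines "B \<equiv> real_of_ereal (ratio_bound PS da pe pb)"
    and "m0 \<equiv> log (1 - \<epsilon>) \<delta>"
    and "C \<equiv> 7 * B / sqrt (\<gamma> * \<epsilon> * (1 - \<epsilon>)) + sqrt (of_int \<lfloor>m0 / \<gamma>\<rfloor> * B) + B / 2"
  defines "Dn \<equiv> \<lambda>\<omega>. \<lambda>i\<in>{..<n}. D i \<omega>"
    and "Vn \<equiv> \<lambda>\<omega>. \<lambda>i\<in>{..<n}. V i \<omega>"
    and "Vspace \<equiv> PiM {..<n} (\<lambda>_. borel :: real measure)"
    and "Drs \<equiv> \<lambda>\<omega>. rejection_sample (weight pe pb) B n (\<lambda>i. D i \<omega>) (\<lambda>i. V i \<omega>)"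
  defines "L \<equiv> miscoverage M (data_space n PS da \<Otimes>\<^sub>M Vspace \<Otimes>\<^sub>M split_space) (\<lambda>\<omega>. (Dn \<omega>, Vn \<omega>, J \<omega>))
                 (\<lambda>\<omega>. prediction_interval q \<epsilon>lo \<epsilon>up \<epsilon> \<delta> (J \<omega>) (Drs \<omega>)) S' R'"
  assumes params: "\<epsilon> \<in> {0<..<1}" "\<delta> \<in> {0<..<1}" "\<gamma> \<in> {0<..<1}" "n \<ge> 1"
    and levels: "\<epsilon>lo \<in> {0..1}" "\<epsilon>up \<in> {0..1}" "\<epsilon>up - \<epsilon>lo = 1 - \<epsilon>"
    and model: "prob_space PS" "PR \<in> PS \<Otimes>\<^sub>M da \<rightarrow>\<^sub>M prob_algebra borel"
    and policies: "policy PS da pb" "policy PS da pe"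
    and B_finite: "ratio_bound PS da pe pb < \<infinity>"
    and training: "measurable_training PS (q \<epsilon>lo)" "measurable_training PS (q \<epsilon>up)"
    and M: "prob_space M"
    and D_iid: "prob_space.indep_vars M (\<lambda>_. PS \<Otimes>\<^sub>M da \<Otimes>\<^sub>M borel) D {..<n}"
      "\<And>i. i < n \<Longrightarrow> distr M (PS \<Otimes>\<^sub>M da \<Otimes>\<^sub>M borel) (D i) = data_law PS da PR pb"
    and V_iid: "prob_space.indep_vars M (\<lambda>_. borel) V {..<n}"
      "\<And>i. i < n \<Longrightarrow> distr M borel (V i) = uniform_measure lborel {0..1}"
    and V_indep: "indep_elements M (data_space n PS da) Dn Vspace Vn"
    and split: "\<And>\<omega> N. \<omega> \<in> space M \<Longrightarrow> J \<omega> N \<subseteq> {..<N}"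
      "\<And>\<omega> N. \<omega> \<in> space M \<Longrightarrow> card (J \<omega> N) = nat \<lceil>\<gamma> * real N\<rceil>"
    and split_indep: "indep_elements M
      (data_space n PS da \<Otimes>\<^sub>M Vspace) (\<lambda>\<omega>. (Dn \<omega>, Vn \<omega>)) split_space J"
    and test_indep: "indep_elements M
      (data_space n PS da \<Otimes>\<^sub>M Vspace \<Otimes>\<^sub>M split_space) (\<lambda>\<omega>. (Dn \<omega>, Vn \<omega>, J \<omega>))
      (PS \<Otimes>\<^sub>M borel) (\<lambda>\<omega>. (S' \<omega>, R' \<omega>))"
    and test_law: "distr M (PS \<Otimes>\<^sub>M borel) (\<lambda>\<omega>. (S' \<omega>, R' \<omega>)) = target_law PS da PR pe"
    and no_ties: "AE \<omega> in M. distinct (calibration_scores q \<epsilon>lo \<epsilon>up (J \<omega>) (Drs \<omega>))"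
  shows "measure M {\<omega> \<in> space M. L \<omega> \<le> \<epsilon>} < 1 - \<delta> + C / sqrt (real n)"
proof -
  interpret prob_space M by (rule M)
  let ?L = "PS \<Otimes>\<^sub>M da \<Otimes>\<^sub>M (borel :: real measure)"
  let ?S = "PS \<Otimes>\<^sub>M (borel :: real measure)"
  let ?Q = "target_law PS da PR pe"
  let ?w = "weight pe pb"
  let ?N = "data_space n PS da \<Otimes>\<^sub>M Vspace \<Otimes>\<^sub>M (split_space :: (nat \<Rightarrow> nat set) measure)"
  let ?X = "\<lambda>\<omega>. (Dn \<omega>, Vn \<omega>, J \<omega>)"
  let ?Y = "\<lambda>\<omega>. (S' \<omega>, R' \<omega>)"
  let ?sc = "cal_score (q \<epsilon>lo) (q \<epsilon>up)"
  let ?th = "cal_threshold \<epsilon> \<delta> (q \<epsilon>lo) (q \<epsilon>up)"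
  let ?acc = "accepted ?w B n"
  let ?A = "\<lambda>\<omega>. ?acc (Dn \<omega>) (Vn \<omega>)"
  have PS: "prob_space PS" and PR: "PR \<in> PS \<Otimes>\<^sub>M da \<rightarrow>\<^sub>M prob_algebra borel" by fact+
  have n: "n > 0" using params by simp
  have B1: "B \<ge> 1" and Bpe: "\<And>s a. s \<in> space PS \<Longrightarrow> a \<in> space da \<Longrightarrow> pe s a \<le> B * pb s a"
    using ratio_bound_props[OF PS policies B_finite] by (auto simp: B_def)
  then have B0: "B > 0" by simp
  have setsQ: "sets ?Q = sets ?S" by (simp add: target_law_def)
  have Q: "prob_space ?Q"
    unfolding target_law_def using sets_data_law[OF PS PR policies(2)]
    by (intro prob_space.prob_space_distr prob_space_data_law PS PR policies)
      (simp add: split_beta' cong: measurable_cong_sets)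
  interpret Q: prob_space ?Q by (rule Q)
  have Dm[measurable]: "D i \<in> M \<rightarrow>\<^sub>M ?L" if "i < n" for i
    using D_iid(1) that by (auto simp: indep_vars_def)
  have Vm[measurable]: "V i \<in> borel_measurable M" if "i < n" for i
    using V_iid(1) that by (auto simp: indep_vars_def)
  have Xm[measurable]: "?X \<in> M \<rightarrow>\<^sub>M ?N" and Ym: "?Y \<in> M \<rightarrow>\<^sub>M ?S"
    using test_indep by (auto simp: indep_elements_def)
  have Jm: "J \<in> M \<rightarrow>\<^sub>M split_space" using split_indep by (auto simp: indep_elements_def)

  \<comment> \<open>A data point and its uniform variable form one unit; the units are independent
    across \<open>i\<close>, and acceptance is a condition on one unit.\<close>
  define W where "W i \<omega> = (D i \<omega>, V i \<omega>)" for i \<omega>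
  let ?Acc = "accept_region PS da ?w B"
  let ?h = "\<lambda>z. (fst (fst z), snd (snd (fst z))) :: 's \<times> real"
  have W: "indep_vars (\<lambda>_. ?L \<Otimes>\<^sub>M borel) W {..<n}"
    unfolding W_def using n V_indep D_iid(1) V_iid(1)
    by (intro indep_vars_pair[OF M]) (auto simp: Dn_def Vn_def data_space_def Vspace_def)
  have h: "?h \<in> ?L \<Otimes>\<^sub>M (borel :: real measure) \<rightarrow>\<^sub>M ?Q"
    using setsQ by (simp cong: measurable_cong_sets)
  have DV: "indep_elements M ?L (D i) borel (V i)" if i: "i < n" for i
  proof -
    have "indep_elements M ?L (\<lambda>\<omega>. Dn \<omega> i) borel (\<lambda>\<omega>. Vn \<omega> i)"
      using i unfolding data_space_def[symmetric]
      by (intro indep_elements_compose[OF M V_indep]) (simp_all add: data_space_def Vspace_def)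
    then show ?thesis using i by (simp add: Dn_def Vn_def)
  qed
  have Acc: "?Acc \<in> sets (?L \<Otimes>\<^sub>M borel)"
    by (rule acceptance_law(1)[OF M PS PR policies B0 Bpe DV[OF n] D_iid(2)[OF n] V_iid(2)[OF n] sets.top])
  have law: "prob {\<omega> \<in> space M. W i \<omega> \<in> ?Acc \<and> ?h (W i \<omega>) \<in> Y} = 1 / B * measure ?Q Y"
    if "i < n" "Y \<in> sets ?Q" for i Y
    using acceptance_law(2)[OF M PS PR policies B0 Bpe DV[OF that(1)] D_iid(2)[OF that(1)] V_iid(2)[OF that(1)], of Y] that(2)
    by (simp add: W_def setsQ)
  have p: "0 \<le> 1 / B" "1 / B \<le> 1" "0 < 1 / B" using B1 by auto
  have A_eq: "?A \<omega> = {i\<in>{..<n}. W i \<omega> \<in> ?Acc}" if "\<omega> \<in> space M" for \<omega>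
    using measurable_space[OF Dm that]
    by (auto simp: accepted_def accept_region_def W_def Dn_def Vn_def space_pair_measure)
  have pick_eq: "pick n A (Dn \<omega>) = (\<lambda>j\<in>{..<card A}. ?h (W (sel n A ! j) \<omega>))" if "A \<subseteq> {..<n}" for A \<omega>
  proof -
    have "sel n A ! j < n" if "j < card A" for j
      using nth_mem[of j "sel n A"] that length_sel[OF \<open>A \<subseteq> {..<n}\<close>] by (auto simp: set_sel)
    then show ?thesis by (auto simp: pick_def W_def Dn_def fun_eq_iff restrict_def)
  qed
  \<comment> \<open>The probability that exactly the indices in \<open>A\<close> are
    accepted.\<close>
  define c where "c A = (1 / B) ^ card A * (1 - 1 / B) ^ (n - card A)" for A :: "nat set"
  have c0: "c A \<ge> 0" for A using p by (simp add: c_def)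
  have piece: "prob {\<omega> \<in> space M. ?A \<omega> = A \<and> pick n A (Dn \<omega>) \<in> Z} = c A * measure (PiM {..<card A} (\<lambda>_. ?Q)) Z"
    if A: "A \<subseteq> {..<n}" and Z: "Z \<in> sets (PiM {..<card A} (\<lambda>_. ?Q))" for A Z
  proof -
    have "{\<omega> \<in> space M. ?A \<omega> = A \<and> pick n A (Dn \<omega>) \<in> Z}
      = {\<omega> \<in> space M. {i\<in>{..<n}. W i \<omega> \<in> ?Acc} = A \<and> (\<lambda>j\<in>{..<card A}. ?h (W (sel n A ! j) \<omega>)) \<in> Z}"
      unfolding pick_eq[OF A] using A_eq by blast
    then show ?thesis using rejection_law[OF M n W Acc h Q p(1,2) law A Z] by (simp only: c_def)
  qed

  have accm: "{z \<in> space (data_space n PS da \<Otimes>\<^sub>M Vspace). ?acc (fst z) (snd z) = A} \<in> sets (data_space n PS da \<Otimes>\<^sub>M Vspace)"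
    if A: "A \<subseteq> {..<n}" for A
  proof -
    have i: "(\<lambda>z. (fst z i, snd z i)) \<in> data_space n PS da \<Otimes>\<^sub>M Vspace \<rightarrow>\<^sub>M ?L \<Otimes>\<^sub>M borel" if "i \<in> {..<n}" for i
      using that unfolding data_space_def Vspace_def by measurable
    have "{z \<in> space (data_space n PS da \<Otimes>\<^sub>M Vspace). ?acc (fst z) (snd z) = A}
      = {z \<in> space (data_space n PS da \<Otimes>\<^sub>M Vspace). \<forall>i\<in>{..<n}. ((fst z i, snd z i) \<in> ?Acc) = (i \<in> A)}"
      using measurable_space[OF i] A by (auto simp: accepted_def accept_region_def)
    also have "\<dots> \<in> sets (data_space n PS da \<Otimes>\<^sub>M Vspace)"
      using i Acc by measurable
    finally show ?thesis .
  qed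
  have pickm: "pick n A \<in> data_space n PS da \<rightarrow>\<^sub>M PiM {..<card A} (\<lambda>_. ?S)" if A: "A \<subseteq> {..<n}" for A
  proof -
    have "sel n A ! j < n" if "j < card A" for j
      using nth_mem[of j "sel n A"] that length_sel[OF A] by (auto simp: set_sel)
    then show ?thesis unfolding pick_def data_space_def
      by (intro measurable_restrict) measurable
  qed
  have setsP: "sets (PiM {..<N} (\<lambda>_. ?Q)) = sets (PiM {..<N} (\<lambda>_. ?S))" for N :: nat
    by (intro sets_PiM_cong setsQ) auto

  \<comment> \<open>The law of the split at a deterministic size. Where the accepted set equals
    \<open>A\<close>, the size is \<open>card A\<close>, so independence of the split from the data
    produces a plain factor.\<close>
  define \<pi> where "\<pi> N K = prob {\<omega> \<in> space M. J \<omega> N = K}" for N K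
  have Jset: "{j \<in> space split_space. j N = K} \<in> sets split_space" if "K \<subseteq> {..<N}" for N K
    using that unfolding split_space_def by measurable
  have J_eq: "{\<omega> \<in> space M. J \<omega> N = K} = {\<omega> \<in> space M. J \<omega> \<in> {j \<in> space split_space. j N = K}}" for N K
    using measurable_space[OF Jm] by auto
  have piece_J: "prob {\<omega> \<in> space M. ?A \<omega> = A \<and> pick n A (Dn \<omega>) \<in> Z \<and> J \<omega> (card A) = K}
      = \<pi> (card A) K * c A * measure (PiM {..<card A} (\<lambda>_. ?Q)) Z"
    if A: "A \<subseteq> {..<n}" and K: "K \<subseteq> {..<card A}" and Z: "Z \<in> sets (PiM {..<card A} (\<lambda>_. ?Q))" for A K Z
  proof -
    let ?DV = "data_space n PS da \<Otimes>\<^sub>M Vspace"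
    let ?T = "{z \<in> space ?DV. ?acc (fst z) (snd z) = A} \<inter> ((\<lambda>z. pick n A (fst z)) -` Z \<inter> space ?DV)"
    have Z': "Z \<in> sets (PiM {..<card A} (\<lambda>_. ?S))" using Z setsP by simp
    have T: "?T \<in> sets ?DV"
      by (rule sets.Int[OF accm[OF A] measurable_sets[OF measurable_compose[OF measurable_fst pickm[OF A]] Z']])
    have DVm: "(\<lambda>\<omega>. (Dn \<omega>, Vn \<omega>)) \<in> M \<rightarrow>\<^sub>M ?DV" using split_indep by (auto simp: indep_elements_def)
    have eq: "{\<omega> \<in> space M. ?A \<omega> = A \<and> pick n A (Dn \<omega>) \<in> Z} = {\<omega> \<in> space M. (Dn \<omega>, Vn \<omega>) \<in> ?T}"
      using measurable_space[OF DVm] by auto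
    have "{\<omega> \<in> space M. ?A \<omega> = A \<and> pick n A (Dn \<omega>) \<in> Z \<and> J \<omega> (card A) = K}
      = {\<omega> \<in> space M. (Dn \<omega>, Vn \<omega>) \<in> ?T \<and> J \<omega> \<in> {j \<in> space split_space. j (card A) = K}}"
      using eq J_eq[of "card A" K] by blast
    then show ?thesis
      using indep_elements_prob[OF M split_indep T Jset[OF K]] piece[OF A Z]
      by (simp only: \<pi>_def J_eq eq mult_ac)
  qed

  let ?Xset = "\<lambda>N K. {x \<in> space (PiM {..<N} (\<lambda>_. ?Q)). excess_prob ?Q (?sc N K x) (?th N K x) \<le> \<epsilon>}"
  have scm: "(\<lambda>(x, y). ?sc N K x y) \<in> borel_measurable (PiM {..<N} (\<lambda>_. ?S) \<Otimes>\<^sub>M ?S)" for N K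
    by (rule measurable_cal_score[OF training]) auto
  have threshm: "?th N K \<in> borel_measurable (PiM {..<N} (\<lambda>_. ?S))" for N K
    by (rule measurable_cal_threshold[OF training])
  have Xset: "?Xset N K \<in> sets (PiM {..<N} (\<lambda>_. ?Q))" for N K
  proof -
    have "(\<lambda>(x, y). ?sc N K x y) \<in> borel_measurable (PiM {..<N} (\<lambda>_. ?Q) \<Otimes>\<^sub>M ?Q)"
      "?th N K \<in> borel_measurable (PiM {..<N} (\<lambda>_. ?Q))"
      using scm[of N K] threshm[of N K] sets_pair_measure_cong[OF setsP setsQ, of N] setsP[of N]
      by (simp_all cong: measurable_cong_sets)
    from measurable_excess_prob[OF Q this] show ?thesis by measurable
  qed
  have pred_eq: "rejection_sample ?w B n (\<lambda>i. D i \<omega>) (\<lambda>i. V i \<omega>) = map (pick n (?A \<omega>) (Dn \<omega>)) [0..<card (?A \<omega>)]" for \<omega>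
  proof -
    have "rejection_sample ?w B n (\<lambda>i. D i \<omega>) (\<lambda>i. V i \<omega>) = rejection_sample ?w B n (Dn \<omega>) (Vn \<omega>)"
      unfolding rejection_sample_def Dn_def Vn_def by (intro map_cong filter_cong) auto
    then show ?thesis by (simp add: rejection_sample_eq)
  qed

  \<comment> \<open>The miss event in the product of the construction data and the test pair. Sample
    size and calibration positions vary with the point, so joint measurability is obtained on the
    finitely many pieces \<open>(A, K)\<close>, where both are constant.\<close>
  define G where "G = {z \<in> space (?N \<Otimes>\<^sub>M ?S). case z of ((d, v, j), y) \<Rightarrow>
    let A = ?acc d v; N = card A in ?th N (j N) (pick n A d) < ereal (?sc N (j N) (pick n A d) y)}"
  have G: "G \<in> sets (?N \<Otimes>\<^sub>M ?S)"
  proof -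
    let ?G = "\<lambda>A K. {z \<in> space (?N \<Otimes>\<^sub>M ?S). ?acc (fst (fst z)) (fst (snd (fst z))) = A \<and> snd (snd (fst z)) (card A) = K
      \<and> ?th (card A) K (pick n A (fst (fst z))) < ereal (?sc (card A) K (pick n A (fst (fst z))) (snd z))}"
    have G_UN: "G = (\<Union>A\<in>Pow {..<n}. \<Union>K\<in>Pow {..<card A}. ?G A K)"
    proof (intro set_eqI iffI)
      fix z assume z: "z \<in> G"
      obtain d v j y where zz: "z = ((d, v, j), y)" by (metis prod_cases4 surj_pair)
      have "j (card (?acc d v)) \<in> Pow {..<card (?acc d v)}"
        using z unfolding zz G_def by (auto simp: space_pair_measure split_space_def space_PiM PiE_iff)
      then show "z \<in> (\<Union>A\<in>Pow {..<n}. \<Union>K\<in>Pow {..<card A}. ?G A K)"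
        using z accepted_subset[of ?w B n d v] unfolding zz G_def by (auto simp: Let_def)
    qed (auto simp: G_def Let_def)
    have GM: "?G A K \<in> sets (?N \<Otimes>\<^sub>M ?S)" if A: "A \<subseteq> {..<n}" and K: "K \<subseteq> {..<card A}" for A K
    proof -
      have 1: "(\<lambda>z. (fst (fst z), fst (snd (fst z)))) \<in> ?N \<Otimes>\<^sub>M ?S \<rightarrow>\<^sub>M data_space n PS da \<Otimes>\<^sub>M Vspace" by measurable
      have 2: "(\<lambda>z. snd (snd (fst z))) \<in> ?N \<Otimes>\<^sub>M ?S \<rightarrow>\<^sub>M split_space" by measurable
      have 30: "(\<lambda>z. pick n A (fst (fst z))) \<in> ?N \<Otimes>\<^sub>M ?S \<rightarrow>\<^sub>M PiM {..<card A} (\<lambda>_. ?S)"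
        by (rule measurable_compose[OF _ pickm[OF A]]) measurable
      have 3: "(\<lambda>z. (pick n A (fst (fst z)), snd z)) \<in> ?N \<Otimes>\<^sub>M ?S \<rightarrow>\<^sub>M PiM {..<card A} (\<lambda>_. ?S) \<Otimes>\<^sub>M ?S"
        by (intro measurable_Pair 30 measurable_snd)
      have 4: "(\<lambda>z. ?th (card A) K (pick n A (fst (fst z)))) \<in> borel_measurable (?N \<Otimes>\<^sub>M ?S)"
        by (rule measurable_compose[OF 30 threshm])
      have 5: "(\<lambda>z. ?sc (card A) K (pick n A (fst (fst z))) (snd z)) \<in> borel_measurable (?N \<Otimes>\<^sub>M ?S)"
        using measurable_compose[OF 3 scm] by simp
      have "?G A K = ((\<lambda>z. (fst (fst z), fst (snd (fst z)))) -` {z \<in> space (data_space n PS da \<Otimes>\<^sub>M Vspace). ?acc (fst z) (snd z) = A} \<inter> space (?N \<Otimes>\<^sub>M ?S))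
        \<inter> ((\<lambda>z. snd (snd (fst z))) -` {j \<in> space split_space. j (card A) = K} \<inter> space (?N \<Otimes>\<^sub>M ?S))
        \<inter> {z \<in> space (?N \<Otimes>\<^sub>M ?S). ?th (card A) K (pick n A (fst (fst z))) < ereal (?sc (card A) K (pick n A (fst (fst z))) (snd z))}"
        using measurable_space[OF 1] measurable_space[OF 2] by auto
      also have "\<dots> \<in> sets (?N \<Otimes>\<^sub>M ?S)"
        by (rule sets.Int[OF sets.Int[OF measurable_sets[OF 1 accm[OF A]] measurable_sets[OF 2 Jset[OF K]]]])
          (use 4 5 in measurable)
      finally show ?thesis .
    qed
    show ?thesis unfolding G_UN using GM by (intro sets.finite_UN finite_Pow_iff[THEN iffD2]) auto
  qed

  \<comment> \<open>An explicit version of the miscoverage; conditional probabilities are determined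
    only up to null sets, so \<open>L\<close> agrees with it almost surely.\<close>
  let ?e = "\<lambda>\<omega>. excess_prob ?Q (?sc (card (?A \<omega>)) (J \<omega> (card (?A \<omega>))) (pick n (?A \<omega>) (Dn \<omega>)))
      (?th (card (?A \<omega>)) (J \<omega> (card (?A \<omega>))) (pick n (?A \<omega>) (Dn \<omega>)))"
  have "AE \<omega> in M. L \<omega> = measure (distr M ?S ?Y) (Pair (?X \<omega>) -` G)"
    unfolding L_def
  proof (rule miscoverage_eq[OF M test_indep G])
    fix \<omega> assume w: "\<omega> \<in> space M"
    have "(?X \<omega>, ?Y \<omega>) \<in> space (?N \<Otimes>\<^sub>M ?S)"
      using measurable_space[OF Xm w] measurable_space[OF Ym w] by (simp add: space_pair_measure[of ?N ?S])
    then show "R' \<omega> \<notin> prediction_interval q \<epsilon>lo \<epsilon>up \<epsilon> \<delta> (J \<omega>) (Drs \<omega>) (S' \<omega>)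
        \<longleftrightarrow> (?X \<omega>, S' \<omega>, R' \<omega>) \<in> G"
      unfolding Drs_def pred_eq not_in_prediction_interval_iff by (simp add: G_def Let_def)
  qed
  then have L_eq: "AE \<omega> in M. L \<omega> = ?e \<omega>"
  proof (rule AE_mp, intro AE_I2 impI)
    fix \<omega> assume w: "\<omega> \<in> space M" and L: "L \<omega> = measure (distr M ?S ?Y) (Pair (?X \<omega>) -` G)"
    have "Pair (?X \<omega>) -` G = {y \<in> space ?Q. ?th (card (?A \<omega>)) (J \<omega> (card (?A \<omega>))) (pick n (?A \<omega>) (Dn \<omega>))
        < ereal (?sc (card (?A \<omega>)) (J \<omega> (card (?A \<omega>))) (pick n (?A \<omega>) (Dn \<omega>)) y)}"
      using measurable_space[OF Xm w] sets_eq_imp_space_eq[OF setsQ]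
      by (auto simp: G_def Let_def space_pair_measure[of ?N ?S])
    then show "L \<omega> = ?e \<omega>" unfolding L test_law by (simp add: excess_prob_def)
  qed

  let ?E = "\<lambda>A K. {\<omega> \<in> space M. ?A \<omega> = A \<and> pick n A (Dn \<omega>) \<in> ?Xset (card A) K \<and> J \<omega> (card A) = K}"
  have EM: "?E A K \<in> events" if A: "A \<subseteq> {..<n}" and K: "K \<subseteq> {..<card A}" for A K
  proof -
    let ?DV = "data_space n PS da \<Otimes>\<^sub>M Vspace"
    have DVm: "(\<lambda>\<omega>. (Dn \<omega>, Vn \<omega>)) \<in> M \<rightarrow>\<^sub>M ?DV" using split_indep by (auto simp: indep_elements_def)
    have Dnm: "(\<lambda>\<omega>. pick n A (Dn \<omega>)) \<in> M \<rightarrow>\<^sub>M PiM {..<card A} (\<lambda>_. ?S)"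
      using measurable_compose[OF measurable_compose[OF DVm measurable_fst] pickm[OF A]] by simp
    have "?E A K = ((\<lambda>\<omega>. (Dn \<omega>, Vn \<omega>)) -` {z \<in> space ?DV. ?acc (fst z) (snd z) = A} \<inter> space M)
      \<inter> ((\<lambda>\<omega>. pick n A (Dn \<omega>)) -` ?Xset (card A) K \<inter> space M) \<inter> (J -` {j \<in> space split_space. j (card A) = K} \<inter> space M)"
      using measurable_space[OF DVm] measurable_space[OF Jm] by auto
    also have "\<dots> \<in> events"
      using Xset[of "card A" K] unfolding setsP
      by (rule sets.Int[OF sets.Int[OF measurable_sets[OF DVm accm[OF A]] measurable_sets[OF Dnm]] measurable_sets[OF Jm Jset[OF K]]])
    finally show ?thesis .
  qed
  have "prob {\<omega> \<in> space M. L \<omega> \<le> \<epsilon>} \<le> prob (\<Union>A\<in>Pow {..<n}. \<Union>K\<in>Pow {..<card A}. ?E A K)"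
  proof (rule finite_measure_mono_AE)
    show "AE \<omega> in M. \<omega> \<in> {\<omega> \<in> space M. L \<omega> \<le> \<epsilon>} \<longrightarrow> \<omega> \<in> (\<Union>A\<in>Pow {..<n}. \<Union>K\<in>Pow {..<card A}. ?E A K)"
      using L_eq
    proof (rule AE_mp, intro AE_I2 impI)
      fix \<omega> assume w: "\<omega> \<in> space M" and L: "L \<omega> = ?e \<omega>" and "\<omega> \<in> {\<omega> \<in> space M. L \<omega> \<le> \<epsilon>}"
      then have e: "?e \<omega> \<le> \<epsilon>" by simp
      have A: "?A \<omega> \<in> Pow {..<n}" using accepted_subset by blast
      have K: "J \<omega> (card (?A \<omega>)) \<in> Pow {..<card (?A \<omega>)}" using split(1)[OF w] by blast
      have "Dn \<omega> \<in> space (data_space n PS da)"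
        using measurable_space[OF Xm w] by (simp add: space_pair_measure)
      then have "pick n (?A \<omega>) (Dn \<omega>) \<in> space (PiM {..<card (?A \<omega>)} (\<lambda>_. ?Q))"
        using measurable_space[OF pickm] A sets_eq_imp_space_eq[OF setsP] by simp
      then have "\<omega> \<in> ?E (?A \<omega>) (J \<omega> (card (?A \<omega>)))" using w e by simp
      then show "\<omega> \<in> (\<Union>A\<in>Pow {..<n}. \<Union>K\<in>Pow {..<card A}. ?E A K)" using A K by blast
    qed
    show "(\<Union>A\<in>Pow {..<n}. \<Union>K\<in>Pow {..<card A}. ?E A K) \<in> events"
      using EM by (intro sets.finite_UN) auto
  qed
  also have "\<dots> \<le> (\<Sum>A\<in>Pow {..<n}. \<Sum>K\<in>Pow {..<card A}. prob (?E A K))"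
    using EM by (intro order_trans[OF finite_measure_subadditive_finite] sum_mono finite_measure_subadditive_finite) (auto intro!: sets.finite_UN)
  also have "\<dots> \<le> (\<Sum>A\<in>Pow {..<n}. \<Sum>K\<in>Pow {..<card A}. \<pi> (card A) K * c A *
      (1 - \<delta> + 1 / sqrt (\<gamma> * \<epsilon> * (1 - \<epsilon>)) / sqrt (real (card A) + 1)))"
  proof (intro sum_mono)
    fix A K assume "A \<in> Pow {..<n}" "K \<in> Pow {..<card A}"
    then have A: "A \<subseteq> {..<n}" and K: "K \<subseteq> {..<card A}" by auto
    let ?P = "PiM {..<card A} (\<lambda>_. ?Q)"
    interpret P: finite_product_prob_space "\<lambda>_. ?Q" "{..<card A}" by standard simp
    have E: "prob (?E A K) = \<pi> (card A) K * c A * measure ?P (?Xset (card A) K)"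
      by (rule piece_J[OF A K Xset])
    show "prob (?E A K) \<le> \<pi> (card A) K * c A *
      (1 - \<delta> + 1 / sqrt (\<gamma> * \<epsilon> * (1 - \<epsilon>)) / sqrt (real (card A) + 1))"
    \<comment> \<open>Pieces of weight 0 contribute nothing. A positive weight supplies an outcome
      whose split is \<open>K\<close>, hence the cardinality of \<open>K\<close>, and allows null
      events of the piece to be transferred.\<close>
    proof (cases "\<pi> (card A) K * c A = 0")
      case True
      show ?thesis unfolding E True by simp
    next
      case False
      have "\<pi> (card A) K \<noteq> 0" using False by auto
      then have "{\<omega> \<in> space M. J \<omega> (card A) = K} \<noteq> {}" unfolding \<pi>_def by (metis measure_empty)
      then have cardK: "card K = nat \<lceil>\<gamma> * real (card A)\<rceil>" using split(2) by blast
      let ?ties = "{x \<in> space ?P. \<not> distinct (map (\<lambda>i. ?sc (card A) K x (x i)) (sel (card A) K))}"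
      have "Measurable.pred ?P (\<lambda>x. distinct (map (\<lambda>i. ?sc (card A) K x (x i)) (sel (card A) K)))"
        using measurable_cal_score_component[OF training, of _ "card A" K] setsP[of "card A"]
        by (intro measurable_pred_distinct) (auto simp: set_sel cong: measurable_cong_sets)
      then have ties: "?ties \<in> sets ?P" by measurable
      have "AE \<omega> in M. \<not> (?A \<omega> = A \<and> pick n A (Dn \<omega>) \<in> ?ties \<and> J \<omega> (card A) = K)"
        using no_ties unfolding Drs_def pred_eq calibration_scores_eq by eventually_elim auto
      then have "prob {\<omega> \<in> space M. ?A \<omega> = A \<and> pick n A (Dn \<omega>) \<in> ?ties \<and> J \<omega> (card A) = K} \<le> prob {}"
        by (intro finite_measure_mono_AE) auto
      then have "prob {\<omega> \<in> space M. ?A \<omega> = A \<and> pick n A (Dn \<omega>) \<in> ?ties \<and> J \<omega> (card A) = K} = 0"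
        by (simp add: measure_le_0_iff)
      \<comment> \<open>The ties event on this piece has probability 0 and equals the positive
        weight times the product measure of \<open>?ties\<close>.\<close>
      then have "measure ?P ?ties = 0" using piece_J[OF A K ties] False by simp
      then have "AE x in ?P. x \<notin> ?ties" using ties by (simp add: P.prob_eq_0)
      then have "AE x in ?P. distinct (map (\<lambda>i. ?sc (card A) K x (x i)) (sel (card A) K))"
        by (rule AE_mp) (intro AE_I2, auto)
      from prob_low_miscoverage_le[OF Q setsQ params(1-3) training K cardK this]
      show ?thesis unfolding E using c0[of A] by (intro mult_left_mono) (auto simp: \<pi>_def)
    qed
  qed
  also have "\<dots> = (\<Sum>A\<in>Pow {..<n}. c A * (1 - \<delta> + 1 / sqrt (\<gamma> * \<epsilon> * (1 - \<epsilon>)) / sqrt (real (card A) + 1)))"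
  proof (intro sum.cong refl)
    fix A :: "nat set"
    have JM: "{\<omega> \<in> space M. J \<omega> N = K} \<in> events" if "K \<subseteq> {..<N}" for N K
    proof -
      have "{\<omega> \<in> space M. J \<omega> N = K} = J -` {j \<in> space split_space. j N = K} \<inter> space M"
        using measurable_space[OF Jm] by auto
      then show ?thesis using measurable_sets[OF Jm Jset[OF that]] by simp
    qed
    \<comment> \<open>The split takes exactly one admissible value at each size, so its weights sum
      to one and the split drops out of the bound.\<close>
    have "(\<Sum>K\<in>Pow {..<card A}. \<pi> (card A) K) = prob (\<Union>K\<in>Pow {..<card A}. {\<omega> \<in> space M. J \<omega> (card A) = K})"
      unfolding \<pi>_def using JM
      by (intro finite_measure_finite_Union[symmetric]) (auto simp: disjoint_family_on_def)
    also have "(\<Union>K\<in>Pow {..<card A}. {\<omega> \<in> space M. J \<omega> (card A) = K}) = space M"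
      using split(1) by blast
    finally have "(\<Sum>K\<in>Pow {..<card A}. \<pi> (card A) K) = 1" by (simp add: prob_space)
    then show "(\<Sum>K\<in>Pow {..<card A}. \<pi> (card A) K * c A * (1 - \<delta> + 1 / sqrt (\<gamma> * \<epsilon> * (1 - \<epsilon>)) / sqrt (real (card A) + 1)))
      = c A * (1 - \<delta> + 1 / sqrt (\<gamma> * \<epsilon> * (1 - \<epsilon>)) / sqrt (real (card A) + 1))"
      by (simp only: mult.assoc mult_1 flip: sum_distrib_right)
  qed
  \<comment> \<open>The summand depends on \<open>A\<close> only through its size; grouping by size
    gives the binomial law of the number of accepted pairs.\<close>
  also have "\<dots> = (\<Sum>k\<le>n. binom_weight n (1 / B) k * (1 - \<delta> + 1 / sqrt (\<gamma> * \<epsilon> * (1 - \<epsilon>)) / sqrt (real k + 1)))"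
    unfolding c_def
    using sum_Pow_card[of "{..<n}" "\<lambda>k. (1 / B) ^ k * (1 - 1 / B) ^ (n - k) * (1 - \<delta> + 1 / sqrt (\<gamma> * \<epsilon> * (1 - \<epsilon>)) / sqrt (real k + 1))"]
    by (simp add: binom_weight_def mult.assoc)
  also have "\<dots> = 1 - \<delta> + 1 / sqrt (\<gamma> * \<epsilon> * (1 - \<epsilon>)) * (\<Sum>k\<le>n. binom_weight n (1 / B) k / sqrt (real k + 1))"
    by (simp add: distrib_left sum.distrib sum_binom_weight sum_distrib_left flip: sum_distrib_right)
  also have "\<dots> < 1 - \<delta> + C / sqrt (real n)"
  proof -
    let ?g = "sqrt (\<gamma> * \<epsilon> * (1 - \<epsilon>))"
    have g: "?g > 0" using params by simp
    have "(\<Sum>k\<le>n. binom_weight n (1 / B) k / sqrt (real k + 1)) \<le> 1 / sqrt (1 / B * (real n + 1))"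
      using p by (intro sum_binom_weight_inverse_sqrt) simp
    also have "\<dots> = sqrt B / sqrt (real n + 1)" using B0 by (simp add: real_sqrt_mult real_sqrt_divide)
    also have "\<dots> < 7 * B / sqrt (real n)"
    proof -
      have "sqrt B \<le> sqrt (B * B)" using B1 by (intro real_sqrt_le_mono) simp
      then have "sqrt B \<le> B" using B0 by simp
      then have "sqrt B / sqrt (real n + 1) \<le> B / sqrt (real n)"
        using n B0 by (intro frac_le) auto
      \<comment> \<open>The strict inequality of the conclusion is gained here, from B < 7
        B.\<close>
      also have "\<dots> < 7 * B / sqrt (real n)" using n B0 by (intro divide_strict_right_mono) auto
      finally show ?thesis .
    qed
    finally have "1 / ?g * (\<Sum>k\<le>n. binom_weight n (1 / B) k / sqrt (real k + 1)) < 1 / ?g * (7 * B / sqrt (real n))"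
      using g by (intro mult_strict_left_mono) auto
    also have "\<dots> = 7 * B / ?g / sqrt (real n)" by simp
    also have "\<dots> \<le> C / sqrt (real n)"
    proof (rule divide_right_mono)
      \<comment> \<open>Both logarithms are negative, so the other summands of \<open>C\<close> are
        nonnegative. The number \<open>m0\<close> marks where (1 - \<epsilon>)^m falls to \<delta>,
        that is, from which calibration size on \<open>kidx\<close> is at least 0.\<close>
      have "m0 \<ge> 0" unfolding m0_def log_def using params by (intro divide_nonpos_nonpos) auto
      then have "0 \<le> \<lfloor>m0 / \<gamma>\<rfloor>" using params by simp
      then have "0 \<le> sqrt (of_int \<lfloor>m0 / \<gamma>\<rfloor> * B) + B / 2" using B0 by simp
      then show "7 * B / ?g \<le> C" unfolding C_def by linarith
    qed simp
    finally show ?thesis by simp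
  qed
  finally show ?thesis .
qed

end
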